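(* Let $\zeta:\mathbb{C}\to\widehat{\mathbb{C}}$ be the Riemann zeta function and let $N_\zeta:\mathbb{C}\to\widehat{\mathbb{C}}$ be the meromorphic function $N_\zeta(z):=z-\dfrac{\zeta(z)}{\zeta'(z)}$. The Riemann hypothesis holds (i.e. every non-trivial zero of $\zeta$ lies on the line $\{s\in\mathbb{C}:\operatorname{Re}s=1/2\}$) if and only if there is no topological disk $D$ contained in the strip $\mathcal{S}'=\{z\in\mathbb{C}:1/2<\operatorname{Re}z<1\}$ satisfying $\overline{N_\zeta(D)}\subset D$.
   Context: $\widehat{\mathbb{C}}=\mathbb{C}\cup\{\infty\}$ is the Riemann sphere; a meromorphic function on $\mathbb{C}$ is regarded as a holomorphic map $\mathbb{C}\to\widehat{\mathbb{C}}$ (removable singularities are filled in). The Riemann zeta function $\zeta$ is the meromorphic continuation to $\mathbb{C}$ of $\sum_{n\ge1}n^{-s}$ ($\operatorname{Re}s>1$). Its trivial zeros are $-2,-4,-6,\dots$; all other zeros are called non-trivial. A topological disk is an open subset of $\mathbb{C}$ homeomorphic to the open unit disk; the closure $\overline{N_\zeta(D)}$ is taken in $\widehat{\mathbb{C}}$. *)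

theory Defs
  imports "HOL-Complex_Analysis.Complex_Analysis"
begin

text \<open>
  The Riemann sphere is the one-point compactification of the complex plane, with
  \<^term>\<open>None\<close> as the point at infinity.
\<close>

definition riemann_sphere :: "complex option topology" where
  "riemann_sphere = Alexandroff_compactification euclidean"

text \<open>
  For \<^term>\<open>f\<close> meromorphic on the plane, \<open>sphere_map f\<close> is \<^term>\<open>f\<close> regarded as a map to the
  sphere. It depends only on the limits of \<^term>\<open>f\<close>, so the values that \<^term>\<open>f\<close> has at poles and
  at removable singularities (e.g. because of \<open>x / 0 = 0\<close>) are irrelevant.
\<close>

definition sphere_map :: "(complex \<Rightarrow> complex) \<Rightarrow> complex \<Rightarrow> complex option" where
  "sphere_map f z = (if is_pole f z then None else Some (remove_sings f z))"

text \<open>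
  The meromorphic continuation of the Dirichlet series \<open>\<Sum>n\<ge>1. n powr -s\<close> to the whole plane.
  The requirement \<^const>\<open>nicely_meromorphic_on\<close> (continuity away from the poles, value 0 at
  the poles) makes it unique as a function. In particular \<open>zeta 1 = 0\<close> by convention, although 1
  is not a zero; zeros are therefore taken with respect to the map to the sphere below.
\<close>

definition is_zeta :: "(complex \<Rightarrow> complex) \<Rightarrow> bool" where
  "is_zeta f \<longleftrightarrow> f nicely_meromorphic_on UNIV \<and>
     (\<forall>s. Re s > 1 \<longrightarrow> (\<lambda>n. of_nat (Suc n) powr - s) sums f s)"

lemma is_zeta_unique:
  assumes "is_zeta f" "is_zeta g"
  shows "f = g"
proof -
  let ?h = "remove_sings (\<lambda>z. f z - g z)"
  have nice: "f nicely_meromorphic_on UNIV" "g nicely_meromorphic_on UNIV"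
    using assms by (auto simp: is_zeta_def)
  hence mero: "f meromorphic_on UNIV" "g meromorphic_on UNIV"
    by (auto simp: nicely_meromorphic_on_def)
  have diff: "(\<lambda>z. f z - g z) meromorphic_on UNIV"
    using mero by (intro meromorphic_intros)
  have eq: "f s = g s" if "Re s > 1" for s
    using assms that sums_unique2 unfolding is_zeta_def by blast
  have zero: "?h s = 0" if "Re s > 1" for s
  proof (rule remove_sings_eqI)
    have "open {s. Re s > 1}" by (rule open_halfspace_Re_gt)
    hence "eventually (\<lambda>w. w \<in> {s. Re s > 1}) (at s)"
      using that by (intro eventually_at_in_open') auto
    hence "eventually (\<lambda>w. f w - g w = 0) (at s)"
      by eventually_elim (use eq in auto)
    thus "(\<lambda>z. f z - g z) \<midarrow>s\<rightarrow> 0"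
      by (rule tendsto_eventually)
  qed
  have "frequently (\<lambda>z. ?h z = 0) (at 2)"
  proof -
    have "open {s. Re s > 1}" by (rule open_halfspace_Re_gt)
    hence "eventually (\<lambda>w. w \<in> {s. Re s > 1}) (at 2)"
      by (intro eventually_at_in_open') auto
    hence "eventually (\<lambda>z. ?h z = 0) (at 2)"
      by eventually_elim (use zero in auto)
    thus ?thesis by (intro eventually_frequently) auto
  qed
  hence hz: "?h w = 0" for w
    using frequently_eq_meromorphic_imp_constant[of ?h 0 2 UNIV w]
          remove_sings_nicely_meromorphic[OF diff] by auto
  have ev: "eventually (\<lambda>w. f w = g w) (at z)" for z
  proof -
    have "eventually (\<lambda>w. remove_sings (\<lambda>z. f z - g z) w = f w - g w) (at z)"
      by (rule eventually_remove_sings_eq_at)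
         (use diff in \<open>auto intro: meromorphic_on_isolated_singularity
                                    meromorphic_on_subset\<close>)
    thus ?thesis by eventually_elim (use hz in auto)
  qed
  show "f = g"
  proof
    fix z
    have pole: "is_pole f z \<longleftrightarrow> is_pole g z"
      using ev[of z] by (intro is_pole_cong) auto
    have lim: "f \<midarrow>z\<rightarrow> c \<longleftrightarrow> g \<midarrow>z\<rightarrow> c" for c
      using ev[of z] by (rule tendsto_cong)
    have "is_pole f z \<and> f z = 0 \<or> f \<midarrow>z\<rightarrow> f z" "is_pole g z \<and> g z = 0 \<or> g \<midarrow>z\<rightarrow> g z"
      using nice by (auto simp: nicely_meromorphic_on_def)
    thus "f z = g z"
      using pole lim by (metis LIM_unique not_tendsto_and_filterlim_at_infinity
          is_pole_def at_neq_bot)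
  qed
qed

definition zeta :: "complex \<Rightarrow> complex" where
  "zeta = (THE f. is_zeta f)"

definition zeta_sphere :: "complex \<Rightarrow> complex option" where
  "zeta_sphere = sphere_map zeta"

definition newton_zeta :: "complex \<Rightarrow> complex option" where
  "newton_zeta = sphere_map (\<lambda>z. z - zeta z / deriv zeta z)"

definition trivial_zeros :: "complex set" where
  "trivial_zeros = {- 2 * of_nat n |n. n \<ge> 1}"

definition riemann_hypothesis :: bool where
  "riemann_hypothesis \<longleftrightarrow>
     (\<forall>s. zeta_sphere s = Some 0 \<and> s \<notin> trivial_zeros \<longrightarrow> Re s = 1 / 2)"

definition topological_disk :: "complex set \<Rightarrow> bool" where
  "topological_disk D \<longleftrightarrow> open D \<and> D homeomorphic ball (0::complex) 1"

end

theory Submission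
  imports Defs
begin

text \<open>
  A zero of \<open>zeta\<close> of order \<open>n\<close> is a fixed point of its Newton map with multiplier \<open>1 - 1 / n\<close>, so every
  sufficiently small round disk around it is mapped well inside itself. Conversely, if the closure of the image of
  a topological disk lies in the disk, then it is a compact subset of the disk, and Brouwer's theorem (on a slightly smaller
  closed ball) gives a fixed point; finite fixed points of the Newton map are zeros. So the right-hand side says that
  there is no zero with \<open>1/2 < Re s < 1\<close>, and it remains to locate the other zeros.

  The continuation and the functional equation come from the Mellin transform of
  \<open>1 / (exp x - 1)\<close>: after subtraction of \<open>1 / x - 1 / 2\<close> the transform converges for \<open>-1 < s < 0\<close>, where
  the partial fraction expansion of the integrand turns it into a multiple of \<open>zeta (1 - s)\<close>. Only real \<open>s\<close>
  (hence only nonnegative integrands) are needed; the identity theorem does the rest. Non-vanishing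
  for \<open>Re s = 1\<close> is the inequality \<open>3 + 4 * cos x + cos (2 * x) \<ge> 0\<close> applied to the Euler product.
\<close>

section \<open>Holomorphy of Mellin transforms\<close>

text \<open>The disks see only zeros with \<open>1/2 < Re s < 1\<close>. A zero with
  \<open>0 < Re s < 1/2\<close> is carried there by the reflection \<open>s\<close> to
  \<open>1 - s\<close>, and the functional equation also identifies the zeros with
  \<open>Re s <= 0\<close>. Since \<open>zeta\<close> is given by a definite description, existence
  of the continuation is itself an obligation. The terms \<open>1 / x - 1 / 2\<close> begin the
  Laurent expansion of \<open>1 / (exp x - 1)\<close> at 0; without them the integrand is O(x),
  which moves the abscissa of convergence to -1. The strip gained in this way lies in the half-plane
  where the series for \<open>zeta (1 - s)\<close> converges, so a formula on
  \<open>Re s > -1\<close> and one on \<open>Re s < 0\<close> can be glued along it. Taking the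
  closure in the sphere matters: a closed set that avoids infinity is compact, so the disk contains
  no pole of the Newton map, which is therefore continuous there, as Brouwer requires.\<close>

definition mellin :: "real set \<Rightarrow> (real \<Rightarrow> real) \<Rightarrow> complex \<Rightarrow> complex" where
  "mellin S f s = (LINT x:S|lborel. of_real (f x) * of_real x powr (s - 1))"

lemma mellin_of_real:
  assumes "S \<subseteq> {0<..}"
  shows "mellin S f (of_real \<sigma>) = of_real (LINT x:S|lborel. f x * x powr (\<sigma> - 1))"
proof -
  have "(\<lambda>x. indicator S x *\<^sub>R (complex_of_real (f x) * complex_of_real x powr (complex_of_real \<sigma> - 1))) =
        (\<lambda>x. complex_of_real (indicator S x *\<^sub>R (f x * x powr (\<sigma> - 1))))"
    using assms by (auto simp: fun_eq_iff indicator_def powr_of_real[symmetric] split: if_splits)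
  thus ?thesis
    unfolding mellin_def set_lebesgue_integral_def by (simp only: integral_complex_of_real)
qed

lemma exp_abs_ln_le:
  assumes "(x::real) > 0" "d \<ge> 0"
  shows "exp (d * \<bar>ln x\<bar>) \<le> x powr d + x powr (-d)"
  using assms by (cases "ln x \<ge> 0") (auto simp: powr_def abs_if)

text \<open>Expanding \<open>x powr (s - s0) = exp ((s - s0) * ln x)\<close> gives a power series in
  \<open>s - s0\<close>, integrated term by term by dominated convergence. Integrability at the two
  real exponents \<open>Re s0 + d\<close> and \<open>Re s0 - d\<close> provides the dominating
  function, because \<open>exp (d * abs (ln x))\<close> is at most
  \<open>x powr d + x powr (-d)\<close>.\<close>

lemma mellin_holomorphic:
  assumes [measurable]: "S \<in> sets borel" "f \<in> borel_measurable borel"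
  assumes S: "S \<subseteq> {0<..}" and "open I"
  assumes int: "\<And>\<sigma>. \<sigma> \<in> I \<Longrightarrow> set_integrable lborel S (\<lambda>x. f x * x powr (\<sigma> - 1))"
  shows "mellin S f holomorphic_on {s. Re s \<in> I}"
proof -
  have "\<exists>d>0. mellin S f holomorphic_on ball s0 d" if s0: "Re s0 \<in> I" for s0
  proof -
    obtain d where d: "d > 0" "cball (Re s0) d \<subseteq> I"
      using s0 \<open>open I\<close> by (meson open_contains_cball)
    define u where "u k x = indicator S x *\<^sub>R
      (of_real (f x) * of_real x powr (s0 - 1) * (complex_of_real (ln x) ^ k / fact k))" for k x
    define w where "w x = \<bar>indicator S x *\<^sub>R (f x * x powr (Re s0 + d - 1))\<bar> +
                          \<bar>indicator S x *\<^sub>R (f x * x powr (Re s0 - d - 1))\<bar>" for x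
    have w: "integrable lborel w"
      using int[of "Re s0 + d"] int[of "Re s0 - d"] d unfolding w_def set_integrable_def
      by (auto simp: dist_norm subset_iff)
    have [measurable]: "u k \<in> borel_measurable borel" for k
      unfolding u_def powr_def by measurable
    \<comment> \<open>Used twice: with \<open>r = cmod (s - s0)\<close> to dominate the partial
      sums, and with \<open>r = d\<close> to make each coefficient integrable.\<close>
    have bound: "(\<Sum>k<n. cmod (u k x) * r ^ k) \<le> w x" if "0 \<le> r" "r \<le> d" for n x r
    proof (cases "x \<in> S")
      case True
      hence x: "x > 0" using S by auto
      have "(\<Sum>k<n. cmod (u k x) * r ^ k) =
            \<bar>f x\<bar> * x powr (Re s0 - 1) * (\<Sum>k<n. (r * \<bar>ln x\<bar>) ^ k / fact k)"
        using True x by (simp add: u_def norm_mult norm_divide norm_power norm_powr_real_powr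
              sum_distrib_left power_mult_distrib mult_ac)
      also have "(\<Sum>k<n. (r * \<bar>ln x\<bar>) ^ k / fact k) \<le> exp (r * \<bar>ln x\<bar>)"
        unfolding exp_def using that summable_exp[of "r * \<bar>ln x\<bar>"]
        by (intro order.trans[OF sum_le_suminf]) (auto simp: divide_inverse mult_ac)
      also have "exp (r * \<bar>ln x\<bar>) \<le> exp (d * \<bar>ln x\<bar>)"
        using that by (simp add: mult_right_mono)
      also have "\<dots> \<le> x powr d + x powr (-d)"
        using exp_abs_ln_le x d by simp
      also have "\<bar>f x\<bar> * x powr (Re s0 - 1) * (x powr d + x powr (-d)) = w x"
        using True x by (simp add: w_def abs_mult ring_distribs powr_add[symmetric] mult.assoc algebra_simps)
      finally show ?thesis
        using x by (simp add: mult_left_mono)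
    qed (auto simp: u_def w_def)
    have "mellin S f holomorphic_on ball s0 d"
    proof (rule power_series_holomorphic)
      fix s assume s: "s \<in> ball s0 d"
      define r where "r = cmod (s - s0)"
      have r: "0 \<le> r" "r \<le> d" using s by (auto simp: r_def dist_norm norm_minus_commute)
      have lim: "(\<lambda>n. LINT x|lborel. (\<Sum>k<n. u k x * (s - s0) ^ k)) \<longlonglongrightarrow>
            (LINT x|lborel. indicator S x *\<^sub>R (of_real (f x) * of_real x powr (s - 1)))"
      proof (rule integral_dominated_convergence[OF _ _ w])
        show "AE x in lborel. (\<lambda>n. \<Sum>k<n. u k x * (s - s0) ^ k) \<longlonglongrightarrow>
               indicator S x *\<^sub>R (of_real (f x) * of_real x powr (s - 1))"
        proof (rule AE_I2)
          fix x show "(\<lambda>n. \<Sum>k<n. u k x * (s - s0) ^ k) \<longlonglongrightarrow>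
               indicator S x *\<^sub>R (of_real (f x) * of_real x powr (s - 1))"
          proof (cases "x \<in> S")
            case True
            hence x: "x > 0" using S by auto
            have "(\<lambda>k. (complex_of_real (ln x) * (s - s0)) ^ k /\<^sub>R fact k) sums
                    exp (complex_of_real (ln x) * (s - s0))"
              by (rule exp_converges)
            hence "(\<lambda>k. of_real (f x) * of_real x powr (s0 - 1) *
                      ((complex_of_real (ln x) * (s - s0)) ^ k /\<^sub>R fact k)) sums
                    (of_real (f x) * of_real x powr (s0 - 1) * exp (complex_of_real (ln x) * (s - s0)))"
              by (rule sums_mult)
            also have "of_real (f x) * of_real x powr (s0 - 1) * exp (complex_of_real (ln x) * (s - s0)) =
                       of_real (f x) * of_real x powr (s - 1)"
              using x by (simp add: powr_def Ln_of_real mult.assoc exp_add[symmetric] algebra_simps)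
            also have "(\<lambda>k. of_real (f x) * of_real x powr (s0 - 1) *
                      ((complex_of_real (ln x) * (s - s0)) ^ k /\<^sub>R fact k)) = (\<lambda>k. u k x * (s - s0) ^ k)"
              using True by (simp add: u_def fun_eq_iff power_mult_distrib scaleR_conv_of_real divide_inverse mult_ac)
            finally show ?thesis using True by (simp add: sums_def)
          qed (auto simp: u_def)
        qed
        show "AE x in lborel. norm (\<Sum>k<n. u k x * (s - s0) ^ k) \<le> w x" for n
        proof (rule AE_I2)
          fix x
          have "norm (\<Sum>k<n. u k x * (s - s0) ^ k) \<le> (\<Sum>k<n. norm (u k x * (s - s0) ^ k))"
            by (rule norm_sum)
          also have "\<dots> = (\<Sum>k<n. cmod (u k x) * r ^ k)"
            by (simp add: norm_mult norm_power r_def)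
          also have "\<dots> \<le> w x" using r by (rule bound)
          finally show "norm (\<Sum>k<n. u k x * (s - s0) ^ k) \<le> w x" .
        qed
        show "(\<lambda>x. indicator S x *\<^sub>R (of_real (f x) * of_real x powr (s - 1))) \<in> borel_measurable lborel"
          unfolding powr_def by measurable
      qed measurable
      have intu: "integrable lborel (u k)" for k
      proof (rule Bochner_Integration.integrable_bound[where f = "\<lambda>x. w x / d ^ k"])
        show "AE x in lborel. norm (u k x) \<le> norm (w x / d ^ k)"
        proof (rule AE_I2)
          fix x
          have "cmod (u k x) * d ^ k \<le> (\<Sum>k<Suc k. cmod (u k x) * d ^ k)"
            using d by (intro member_le_sum) auto
          also have "\<dots> \<le> w x" using d by (intro bound) auto
          finally have "cmod (u k x) \<le> w x / d ^ k" using d by (simp add: field_simps)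
          thus "norm (u k x) \<le> norm (w x / d ^ k)" by (metis abs_ge_self order_trans real_norm_def)
        qed
      qed (use w in auto)
      have "(LINT x|lborel. (\<Sum>k<n. u k x * (s - s0) ^ k)) = (\<Sum>k<n. (LINT x|lborel. u k x) * (s - s0) ^ k)" for n
        using intu by (subst Bochner_Integration.integral_sum) auto
      with lim show "(\<lambda>k. (LINT x|lborel. u k x) * (s - s0) ^ k) sums mellin S f s"
        by (simp add: sums_def mellin_def set_lebesgue_integral_def)
    qed
    with d show ?thesis by blast
  qed
  hence "mellin S f field_differentiable at s" if "Re s \<in> I" for s
    using that holomorphic_on_imp_differentiable_at[of "mellin S f" _ s] by (metis centre_in_ball open_ball)
  thus ?thesis
    by (simp add: holomorphic_on_def field_differentiable_at_within)
qed

section \<open>The partial fraction expansion of the Bose function\<close>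

text \<open>Differentiate the reflection formula in the form
  \<open>rGamma z * rGamma (1 - z) = sin (pi * z) / pi\<close>, whose two sides are entire, and
  compare the derivatives.\<close>

lemma Digamma_reflection:
  fixes z :: complex
  assumes "z \<notin> \<int>"
  shows "Digamma (1 - z) - Digamma z = of_real pi * cot (of_real pi * z)"
proof -
  have z: "z \<notin> \<int>\<^sub>\<le>\<^sub>0" using assms nonpos_Ints_subset_Ints by blast
  have "1 - z \<notin> \<int>" using assms Ints_diff[of 1 "1 - z"] by auto
  hence z': "1 - z \<notin> \<int>\<^sub>\<le>\<^sub>0" using nonpos_Ints_subset_Ints by blast
  have "((\<lambda>z. rGamma z * rGamma (1 - z)) has_field_derivative
           rGamma z * rGamma (1 - z) * (Digamma (1 - z) - Digamma z)) (at z)"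
    using z z' by (auto intro!: derivative_eq_intros simp: algebra_simps)
  moreover have "((\<lambda>z. sin (of_real pi * z) / of_real pi) has_field_derivative cos (of_real pi * z)) (at z)"
    by (auto intro!: derivative_eq_intros)
  ultimately have "rGamma z * rGamma (1 - z) * (Digamma (1 - z) - Digamma z) = cos (of_real pi * z)"
    by (simp add: rGamma_reflection_complex DERIV_unique)
  moreover have "sin (of_real pi * z) \<noteq> 0"
    using assms by (auto simp: sin_eq_0)
  ultimately show ?thesis
    by (simp add: rGamma_reflection_complex cot_def field_simps)
qed

text \<open>\<open>1 / x - 1 / 2\<close> is the singular and constant part of
  \<open>1 / (exp x - 1)\<close> at 0, so this remainder is O(x) there; as x grows it tends to
  1/2.\<close>

definition bose_tail :: "real \<Rightarrow> real" where
  "bose_tail x = 1 / (exp x - 1) - 1 / x + 1 / 2"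

text \<open>With \<open>z = i * x / (2 * pi)\<close>, \<open>cot (pi * z)\<close> is -i times
  \<open>coth (x / 2) = 1 + 2 / (exp x - 1)\<close>; its partial fractions come from the Digamma
  series at \<open>1 - z\<close> and \<open>1 + z\<close>.\<close>

lemma bose_tail_sums:
  assumes x: "x > 0"
  shows "(\<lambda>n. 2 * x / (x\<^sup>2 + (2 * pi * real (Suc n))\<^sup>2)) sums bose_tail x"
proof -
  define y where "y = x / (2 * pi)"
  define z where "z = \<i> * complex_of_real y"
  have y: "y > 0" using x by (simp add: y_def)
  have z: "z \<notin> \<int>" using y by (auto simp: z_def complex_is_Int_iff)
  have nz: "1 + z \<noteq> 0" "1 - z \<noteq> 0" "z \<noteq> 0" using y by (auto simp: z_def complex_eq_iff)
  have "(\<lambda>k. inverse (of_nat (Suc k)) - inverse (u + of_nat k)) sums (Digamma u + euler_mascheroni)"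
    if "u \<noteq> 0" for u :: complex
    using summable_Digamma[OF that] by (simp add: Digamma_def summable_sums)
  \<comment> \<open>The Euler constants and the terms \<open>1 / (k + 1)\<close> cancel in the
    difference.\<close>
  from sums_diff[OF this[OF nz(2)] this[OF nz(1)]]
  have "(\<lambda>k. inverse (1 + z + of_nat k) - inverse (1 - z + of_nat k)) sums (Digamma (1 - z) - Digamma (1 + z))"
    by simp
  also have "Digamma (1 - z) - Digamma (1 + z) = of_real pi * cot (of_real pi * z) - 1 / z"
    using Digamma_reflection[OF z] Digamma_plus1[OF nz(3)] by (simp add: add.commute algebra_simps)
  also have "(\<lambda>k. inverse (1 + z + of_nat k) - inverse (1 - z + of_nat k)) =
             (\<lambda>k. - \<i> * of_real (2 * y / (y\<^sup>2 + (real (Suc k))\<^sup>2)))"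
  proof
    fix k
    have a: "1 + z + of_nat k = Complex (real (Suc k)) y" "1 - z + of_nat k = Complex (real (Suc k)) (-y)"
      by (auto simp: z_def complex_eq_iff)
    show "inverse (1 + z + of_nat k) - inverse (1 - z + of_nat k) =
           - \<i> * of_real (2 * y / (y\<^sup>2 + (real (Suc k))\<^sup>2))"
      unfolding a by (simp add: complex_eq_iff add.commute del: of_nat_Suc)
  qed
  also have "of_real pi * cot (of_real pi * z) - 1 / z =
             - \<i> * of_real (pi * (1 + 2 / (exp x - 1)) - 1 / y)"
  proof -
    define E where "E = exp (complex_of_real (pi * y))"
    have E2: "E * E = of_real (exp x)"
      unfolding E_def exp_of_real by (simp add: y_def flip: exp_add of_real_mult)
    have [simp]: "E \<noteq> 0" by (simp add: E_def)
    have "exp x \<noteq> 1" using x by simp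
    hence ne: "E * E - 1 \<noteq> 0" unfolding E2 by (metis eq_iff_diff_eq_0 of_real_eq_1_iff)
    have "cot (of_real pi * z) = ((E + inverse E) / 2) / (\<i> * ((E - inverse E) / 2))"
    proof -
      have "of_real pi * z = \<i> * complex_of_real (pi * y)" by (simp add: z_def)
      thus ?thesis by (simp only: cot_def sin_i_times cos_i_times E_def)
    qed
    also have "\<dots> = - \<i> * (1 + 2 / (E * E - 1))"
      using ne by (simp add: field_simps)
    also have "\<dots> = - \<i> * of_real (1 + 2 / (exp x - 1))"
      unfolding E2 by simp
    finally have "cot (of_real pi * z) = - \<i> * of_real (1 + 2 / (exp x - 1))" .
    moreover have "1 / z = - \<i> * of_real (1 / y)" using y by (simp add: z_def field_simps)
    ultimately show ?thesis by (simp only: of_real_diff of_real_mult) (simp only: algebra_simps)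
  qed
  \<comment> \<open>Both sides are purely imaginary; multiplying by i and taking real parts returns
    to a real series.\<close>
  finally have "(\<lambda>k. Re (\<i> * (- \<i> * of_real (2 * y / (y\<^sup>2 + (real (Suc k))\<^sup>2))))) sums
                 Re (\<i> * (- \<i> * of_real (pi * (1 + 2 / (exp x - 1)) - 1 / y)))"
    by (intro sums_Re[OF sums_mult])
  hence "(\<lambda>k. 2 * y / (y\<^sup>2 + (real (Suc k))\<^sup>2)) sums (pi * (1 + 2 / (exp x - 1)) - 1 / y)"
    by simp
  hence "(\<lambda>k. 1 / (2 * pi) * (2 * y / (y\<^sup>2 + (real (Suc k))\<^sup>2))) sums
           (1 / (2 * pi) * (pi * (1 + 2 / (exp x - 1)) - 1 / y))"
    by (rule sums_mult)
  also have "1 / (2 * pi) * (pi * (1 + 2 / (exp x - 1)) - 1 / y) = bose_tail x"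
    using x by (simp add: bose_tail_def y_def field_simps)
  also have "(\<lambda>k. 1 / (2 * pi) * (2 * y / (y\<^sup>2 + (real (Suc k))\<^sup>2))) =
             (\<lambda>n. 2 * x / (x\<^sup>2 + (2 * pi * real (Suc n))\<^sup>2))"
  proof
    fix k
    have "x = 2 * pi * y" by (simp add: y_def)
    moreover have "(2 * pi * y)\<^sup>2 + (2 * pi * real (Suc k))\<^sup>2 = (2 * pi)\<^sup>2 * (y\<^sup>2 + (real (Suc k))\<^sup>2)"
      by (simp add: algebra_simps power2_eq_square)
    ultimately show "1 / (2 * pi) * (2 * y / (y\<^sup>2 + (real (Suc k))\<^sup>2)) =
       2 * x / (x\<^sup>2 + (2 * pi * real (Suc k))\<^sup>2)"
      by (simp add: power2_eq_square del: of_nat_Suc)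
  qed
  finally show ?thesis .
qed

lemma bose_tail_nonneg: "x > 0 \<Longrightarrow> bose_tail x \<ge> 0"
  by (rule sums_le[OF _ sums_zero bose_tail_sums]) auto

text \<open>Dropping the square of x from the denominators leaves a multiple of the sum of
  \<open>1 / n^2\<close>, whose value \<open>pi^2 / 6\<close> produces the 1/12.\<close>

lemma bose_tail_le:
  assumes "x > 0"
  shows "bose_tail x \<le> x / 12"
proof -
  have "(\<lambda>n. x / (2 * pi\<^sup>2) * (1 / (real n + 1)\<^sup>2)) sums (x / (2 * pi\<^sup>2) * (pi\<^sup>2 / 6))"
    using inverse_squares_sums by (intro sums_mult) (simp add: add.commute)
  also have "x / (2 * pi\<^sup>2) * (pi\<^sup>2 / 6) = x / 12" by simp
  finally have lim: "(\<lambda>n. x / (2 * pi\<^sup>2) * (1 / (real n + 1)\<^sup>2)) sums (x / 12)" .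
  show ?thesis
  proof (rule sums_le[OF _ bose_tail_sums[OF assms] lim])
    fix n
    have "2 * x / (x\<^sup>2 + (2 * pi * real (Suc n))\<^sup>2) \<le> 2 * x / ((2 * pi * real (Suc n))\<^sup>2)"
      using assms by (intro divide_left_mono mult_pos_pos add_nonneg_pos) (auto simp del: of_nat_Suc)
    also have "\<dots> = x / (2 * pi\<^sup>2) * (1 / (real n + 1)\<^sup>2)"
      by (simp add: power_mult_distrib add.commute)
    finally show "2 * x / (x\<^sup>2 + (2 * pi * real (Suc n))\<^sup>2) \<le> x / (2 * pi\<^sup>2) * (1 / (real n + 1)\<^sup>2)" .
  qed
qed

lemma bose_tail_measurable [measurable]: "bose_tail \<in> borel_measurable borel"
  unfolding bose_tail_def by measurable

section \<open>Mellin integrals on the real line\<close>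

text \<open>All integrals are first evaluated as extended nonnegative integrals, where sums and
  integrals may be interchanged freely; this passes from such a finite value to integrability and
  the Lebesgue integral.\<close>

lemma set_integral_nonnegI:
  fixes f :: "real \<Rightarrow> real"
  assumes [measurable]: "S \<in> sets borel" "f \<in> borel_measurable borel"
    and "\<And>x. x \<in> S \<Longrightarrow> f x \<ge> 0" "c \<ge> 0"
    and "(\<integral>\<^sup>+x. ennreal (indicator S x * f x) \<partial>lborel) = ennreal c"
  shows "set_integrable lborel S f" "(LINT x:S|lborel. f x) = c"
proof -
  have "has_bochner_integral lborel (\<lambda>x. indicator S x * f x) c"
    using assms by (intro has_bochner_integral_nn_integral) (auto simp: indicator_def)
  thus "set_integrable lborel S f" "(LINT x:S|lborel. f x) = c"
    by (auto simp: has_bochner_integral_iff set_integrable_def set_lebesgue_integral_def)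
qed

lemma nn_integral_Gamma_scaled:
  assumes s: "s > 0" and a: "a > (0::real)"
  shows "(\<integral>\<^sup>+x. ennreal (indicator {0<..} x * (x powr (s - 1) * exp (- (a * x)))) \<partial>lborel) =
           ennreal (Gamma s * a powr (-s))"
proof -
  let ?h = "\<lambda>x. ennreal (indicator {0<..} x * (x powr (s - 1) * exp (- (a * x))))"
  have "(\<integral>\<^sup>+x. ?h x \<partial>lborel) = \<bar>1 / a\<bar> * (\<integral>\<^sup>+x. ?h (0 + 1 / a * x) \<partial>lborel)"
    using a by (intro nn_integral_real_affine) auto
  also have "(\<integral>\<^sup>+x. ?h (0 + 1 / a * x) \<partial>lborel) =
      (\<integral>\<^sup>+x. ennreal (a powr (1 - s)) * ennreal (indicator {0..} x * x powr (s - 1) / exp x) \<partial>lborel)"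
  proof (intro nn_integral_cong)
    fix x :: real
    show "?h (0 + 1 / a * x) = ennreal (a powr (1 - s)) * ennreal (indicator {0..} x * x powr (s - 1) / exp x)"
    proof (cases "x > 0")
      case True
      have "(x / a) powr (s - 1) = a powr (1 - s) * x powr (s - 1)"
        using a True by (simp add: powr_divide powr_diff field_simps)
      thus ?thesis using a True
        by (simp add: ennreal_mult[symmetric] exp_minus field_simps)
    next
      case False
      thus ?thesis using a by (cases "x = 0") (auto simp: indicator_def zero_less_divide_iff)
    qed
  qed
  also have "\<dots> = ennreal (a powr (1 - s)) * ennreal (Gamma s)"
    unfolding Gamma_conv_nn_integral_real[OF s] by (rule nn_integral_cmult) auto
  also have "ennreal \<bar>1 / a\<bar> * (ennreal (a powr (1 - s)) * ennreal (Gamma s)) =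
             ennreal (1 / a * (a powr (1 - s) * Gamma s))"
    using a s by (simp add: ennreal_mult[symmetric] Gamma_real_nonneg)
  also have "1 / a * (a powr (1 - s) * Gamma s) = Gamma s * a powr (-s)"
    using a by (simp add: powr_diff powr_minus field_simps)
  finally show ?thesis .
qed

text \<open>Geometric series in \<open>exp (-x)\<close>, integrated term by term: each term is a
  scaled Gamma integral.\<close>

lemma nn_integral_bose:
  assumes s: "s > 1"
  shows "(\<integral>\<^sup>+x. ennreal (indicator {0<..} x * (1 / (exp x - 1) * x powr (s - 1))) \<partial>lborel) =
           ennreal (Gamma s * (\<Sum>n. real (Suc n) powr (-s)))"
proof -
  let ?f = "\<lambda>n x. indicator {0<..} x * (x powr (s - 1) * exp (- (real (Suc n) * x)))"
  have "(\<integral>\<^sup>+x. ennreal (indicator {0<..} x * (1 / (exp x - 1) * x powr (s - 1))) \<partial>lborel) =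
        (\<integral>\<^sup>+x. (\<Sum>n. ennreal (?f n x)) \<partial>lborel)"
  proof (intro nn_integral_cong)
    fix x :: real
    show "ennreal (indicator {0<..} x * (1 / (exp x - 1) * x powr (s - 1))) = (\<Sum>n. ennreal (?f n x))"
    proof (cases "x > 0")
      case True
      have "(\<lambda>n. exp (-x) ^ n) sums (1 / (1 - exp (-x)))"
        using True by (intro geometric_sums) auto
      hence "(\<lambda>n. x powr (s - 1) * (exp (-x) * exp (-x) ^ n)) sums (x powr (s - 1) * (exp (-x) * (1 / (1 - exp (-x)))))"
        by (intro sums_mult)
      also have "(\<lambda>n. x powr (s - 1) * (exp (-x) * exp (-x) ^ n)) = (\<lambda>n. ?f n x)"
        using True by (simp add: exp_of_nat_mult[symmetric] exp_add[symmetric] ring_distribs)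
      also have "x powr (s - 1) * (exp (-x) * (1 / (1 - exp (-x)))) = 1 / (exp x - 1) * x powr (s - 1)"
        using True by (simp add: exp_minus field_simps)
      finally have "(\<Sum>n. ennreal (?f n x)) = ennreal (1 / (exp x - 1) * x powr (s - 1))"
        using True by (intro suminf_ennreal_eq) auto
      thus ?thesis using True by simp
    qed auto
  qed
  also have "\<dots> = (\<Sum>n. \<integral>\<^sup>+x. ennreal (?f n x) \<partial>lborel)"
    by (rule nn_integral_suminf) auto
  also have "\<dots> = (\<Sum>n. ennreal (Gamma s * real (Suc n) powr (-s)))"
    using s by (subst nn_integral_Gamma_scaled) auto
  also have "\<dots> = ennreal (Gamma s * (\<Sum>n. real (Suc n) powr (-s)))"
  proof (rule suminf_ennreal_eq)
    have "summable (\<lambda>n. real n powr (-s))" using s by (simp add: summable_real_powr_iff)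
    hence "summable (\<lambda>n. real (Suc n) powr (-s))" by (subst summable_Suc_iff)
    thus "(\<lambda>n. Gamma s * real (Suc n) powr (-s)) sums (Gamma s * (\<Sum>n. real (Suc n) powr (-s)))"
      by (intro sums_mult summable_sums)
  qed (use s in \<open>auto simp: Gamma_real_nonneg\<close>)
  finally show ?thesis .
qed

text \<open>Replace \<open>1 / (1 + v)\<close> by the integral of
  \<open>exp (- (t * (1 + v)))\<close> over t > 0; after exchanging the order of integration, both
  integrals are Gamma integrals.\<close>

lemma nn_integral_powr_over_1_plus:
  assumes a: "0 < a" "a < (1::real)"
  shows "(\<integral>\<^sup>+v. ennreal (indicator {0<..} v * (v powr (a - 1) / (1 + v))) \<partial>lborel) =
           ennreal (Gamma a * Gamma (1 - a))"
proof -
  let ?F = "\<lambda>t v. ennreal (indicator {0<..} t * indicator {0<..} v * (v powr (a - 1) * exp (- (t * (1 + v)))))"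
  have "(\<integral>\<^sup>+v. ennreal (indicator {0<..} v * (v powr (a - 1) / (1 + v))) \<partial>lborel) =
        (\<integral>\<^sup>+v. \<integral>\<^sup>+t. ?F t v \<partial>lborel \<partial>lborel)"
  proof (intro nn_integral_cong)
    fix v :: real
    show "ennreal (indicator {0<..} v * (v powr (a - 1) / (1 + v))) = (\<integral>\<^sup>+t. ?F t v \<partial>lborel)"
    proof (cases "v > 0")
      case True
      have "(\<integral>\<^sup>+t. ?F t v \<partial>lborel) = (\<integral>\<^sup>+t. ennreal (v powr (a - 1)) *
             ennreal (indicator {0<..} t * (t powr (1 - 1) * exp (- ((1 + v) * t)))) \<partial>lborel)"
        using True by (intro nn_integral_cong) (auto simp: indicator_def ennreal_mult[symmetric] mult_ac)
      also have "\<dots> = ennreal (v powr (a - 1)) * ennreal (Gamma 1 * (1 + v) powr (-1))"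
        using True by (subst nn_integral_cmult, simp, subst nn_integral_Gamma_scaled) auto
      also have "\<dots> = ennreal (v powr (a - 1) / (1 + v))"
        using True by (simp add: ennreal_mult[symmetric] powr_minus divide_inverse)
      finally show ?thesis using True by simp
    qed auto
  qed
  also have "\<dots> = (\<integral>\<^sup>+t. \<integral>\<^sup>+v. ?F t v \<partial>lborel \<partial>lborel)"
    by (rule lborel_pair.Fubini') measurable
  also have "\<dots> = (\<integral>\<^sup>+t. ennreal (Gamma a) *
             ennreal (indicator {0<..} t * (t powr ((1 - a) - 1) * exp (- (1 * t)))) \<partial>lborel)"
  proof (intro nn_integral_cong)
    fix t :: real
    show "(\<integral>\<^sup>+v. ?F t v \<partial>lborel) = ennreal (Gamma a) *
             ennreal (indicator {0<..} t * (t powr ((1 - a) - 1) * exp (- (1 * t))))"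
    proof (cases "t > 0")
      case True
      have "(\<integral>\<^sup>+v. ?F t v \<partial>lborel) = (\<integral>\<^sup>+v. ennreal (exp (-t)) *
             ennreal (indicator {0<..} v * (v powr (a - 1) * exp (- (t * v)))) \<partial>lborel)"
        using True by (intro nn_integral_cong)
          (auto simp: indicator_def ennreal_mult[symmetric] ring_distribs exp_add[symmetric] mult_ac mult_exp_exp)
      also have "\<dots> = ennreal (exp (-t)) * ennreal (Gamma a * t powr (-a))"
        using True a by (subst nn_integral_cmult, simp, subst nn_integral_Gamma_scaled) auto
      finally show ?thesis using True a
        by (simp add: ennreal_mult[symmetric] Gamma_real_nonneg mult_ac)
    qed auto
  qed
  also have "\<dots> = ennreal (Gamma a) * ennreal (Gamma (1 - a) * 1 powr (- (1 - a)))"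
    using a by (subst nn_integral_cmult, simp, subst nn_integral_Gamma_scaled) auto
  also have "\<dots> = ennreal (Gamma a * Gamma (1 - a))"
    using a by (simp add: ennreal_mult[symmetric] Gamma_real_nonneg)
  finally show ?thesis .
qed

lemma Gamma_reflection_real:
  fixes a :: real
  shows "Gamma a * Gamma (1 - a) = pi / sin (pi * a)"
proof -
  have "complex_of_real (Gamma a * Gamma (1 - a)) = Gamma (of_real a) * Gamma (1 - of_real a)"
    by (simp flip: Gamma_complex_of_real)
  also have "\<dots> = of_real (pi / sin (pi * a))"
    by (subst Gamma_reflection_complex) (simp add: sin_of_real flip: of_real_mult)
  finally show ?thesis by (simp only: of_real_eq_iff)
qed

text \<open>Substitute \<open>v = u^2\<close> in \<open>nn_integral_powr_over_1_plus\<close>, then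
  apply Gamma reflection.\<close>

lemma nn_integral_powr_over_1_plus_square:
  assumes s: "-1 < s" "s < (1::real)"
  shows "(\<integral>\<^sup>+u. ennreal (indicator {0<..} u * (u powr s / (1 + u\<^sup>2))) \<partial>lborel) =
           ennreal (pi / (2 * sin (pi * ((s + 1) / 2))))"
proof -
  \<comment> \<open>Chosen so that \<open>2 * a - 1 = s\<close>, the exponent that the substitution
    and its Jacobian \<open>2 * u\<close> produce.\<close>
  define a where "a = (s + 1) / 2"
  define c where "c = pi / sin (pi * a)"
  have a: "0 < a" "a < 1" using s by (auto simp: a_def)
  have "sin (pi * a) > 0" using a by (intro sin_gt_zero) auto
  hence c: "c \<ge> 0" by (simp add: c_def)
  let ?f = "\<lambda>v::real. v powr (a - 1) / (1 + v)"
  have f: "set_integrable lborel {0<..} ?f" "(LINT v:{0<..}|lborel. ?f v) = c"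
    by (rule set_integral_nonnegI; use a c nn_integral_powr_over_1_plus[OF a] in
        \<open>simp add: Gamma_reflection_real c_def\<close>)+
  have "?f absolutely_integrable_on {0<..}"
    using f(1) unfolding set_integrable_def by (subst integrable_completion) auto
  moreover have "integral {0<..} ?f = c"
    using set_borel_integral_eq_integral[OF f(1)] f(2) by simp
  moreover have "(\<lambda>u::real. u\<^sup>2) ` {0<..} = {0<..}"
  proof safe
    fix v :: real assume "v > 0"
    thus "v \<in> (\<lambda>u::real. u\<^sup>2) ` {0<..}" by (intro image_eqI[of _ _ "sqrt v"]) auto
  qed auto
  ultimately have "(\<lambda>u. \<bar>2 * u\<bar> * ?f (u\<^sup>2)) absolutely_integrable_on {0<..} \<and>
                   integral {0<..} (\<lambda>u. \<bar>2 * u\<bar> * ?f (u\<^sup>2)) = c"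
    by (subst has_absolute_integral_change_of_variables_1'[where g = "\<lambda>u. u\<^sup>2"])
       (auto intro!: derivative_eq_intros inj_onI simp: power2_eq_iff)
  hence "((\<lambda>u. \<bar>2 * u\<bar> * ?f (u\<^sup>2)) has_integral c) {0<..}"
    using set_lebesgue_integral_eq_integral(1) by (auto simp: has_integral_integrable_integral)
  hence "(\<integral>\<^sup>+u. ennreal (indicator {0<..} u * (\<bar>2 * u\<bar> * ?f (u\<^sup>2))) \<partial>lborel) = ennreal c"
    by (intro nn_integral_has_integral_lebesgue) (auto simp: add_nonneg_nonneg)
  also have "(\<lambda>u. ennreal (indicator {0<..} u * (\<bar>2 * u\<bar> * ?f (u\<^sup>2)))) =
             (\<lambda>u. ennreal 2 * ennreal (indicator {0<..} u * (u powr s / (1 + u\<^sup>2))))"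
  proof
    fix u :: real
    show "ennreal (indicator {0<..} u * (\<bar>2 * u\<bar> * ?f (u\<^sup>2))) =
          ennreal 2 * ennreal (indicator {0<..} u * (u powr s / (1 + u\<^sup>2)))"
    proof (cases "u > 0")
      case True
      have "u * (u\<^sup>2) powr (a - 1) = u powr 1 * (u powr 2) powr (a - 1)" using True by simp
      also have "\<dots> = u powr s" unfolding powr_powr powr_add[symmetric] by (simp add: a_def field_simps)
      finally show ?thesis using True by (simp add: ennreal_mult[symmetric] del: ennreal_numeral)
    qed auto
  qed
  also have "(\<integral>\<^sup>+u. ennreal 2 * ennreal (indicator {0<..} u * (u powr s / (1 + u\<^sup>2))) \<partial>lborel) =
             ennreal 2 * (\<integral>\<^sup>+u. ennreal (indicator {0<..} u * (u powr s / (1 + u\<^sup>2))) \<partial>lborel)"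
    by (rule nn_integral_cmult) auto
  finally have two: "ennreal 2 * (\<integral>\<^sup>+u. ennreal (indicator {0<..} u * (u powr s / (1 + u\<^sup>2))) \<partial>lborel) = ennreal c"
    by simp
  have half: "ennreal (1 / 2) * ennreal 2 = 1"
    by (subst ennreal_mult[symmetric]) auto
  have "(\<integral>\<^sup>+u. ennreal (indicator {0<..} u * (u powr s / (1 + u\<^sup>2))) \<partial>lborel) = ennreal (1 / 2) * ennreal c"
    unfolding two[symmetric] mult.assoc[symmetric] half by simp
  also have "\<dots> = ennreal (1 / 2 * c)"
    using c by (subst ennreal_mult) auto
  finally show ?thesis by (simp add: c_def a_def)
qed

text \<open>Term-by-term integration of \<open>bose_tail_sums\<close>. Scaling by
  \<open>b n = 2 * pi * (n + 1)\<close> reduces each term to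
  \<open>nn_integral_powr_over_1_plus_square\<close>, so the constant is common to all terms and the
  powers of \<open>n + 1\<close> sum to the series for zeta at \<open>1 - s\<close>, convergent as s
  < 0.\<close>

lemma nn_integral_bose_tail:
  assumes s: "-1 < s" "s < (0::real)"
  shows "(\<integral>\<^sup>+x. ennreal (indicator {0<..} x * (bose_tail x * x powr (s - 1))) \<partial>lborel) =
           ennreal ((2 * pi) powr (s - 1) * (pi / sin (pi * ((s + 1) / 2))) * (\<Sum>n. real (Suc n) powr (s - 1)))"
proof -
  define K where "K = pi / (2 * sin (pi * ((s + 1) / 2)))"
  have "sin (pi * ((s + 1) / 2)) > 0" using s by (intro sin_gt_zero) auto
  hence K: "K \<ge> 0" by (simp add: K_def)
  define b where "b n = 2 * pi * real (Suc n)" for n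
  have b: "b n > 0" for n by (simp add: b_def)
  let ?f = "\<lambda>n x. indicator {0<..} x * (2 * x / (x\<^sup>2 + (b n)\<^sup>2) * x powr (s - 1))"
  have "(\<integral>\<^sup>+x. ennreal (indicator {0<..} x * (bose_tail x * x powr (s - 1))) \<partial>lborel) =
        (\<integral>\<^sup>+x. (\<Sum>n. ennreal (?f n x)) \<partial>lborel)"
  proof (intro nn_integral_cong)
    fix x :: real
    show "ennreal (indicator {0<..} x * (bose_tail x * x powr (s - 1))) = (\<Sum>n. ennreal (?f n x))"
    proof (cases "x > 0")
      case True
      have "(\<lambda>n. ?f n x) sums (bose_tail x * x powr (s - 1))"
        using sums_mult2[OF bose_tail_sums[OF True], of "x powr (s - 1)"] True by (simp add: b_def)
      hence "(\<Sum>n. ennreal (?f n x)) = ennreal (bose_tail x * x powr (s - 1))"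
        using True by (intro suminf_ennreal_eq) auto
      thus ?thesis using True by simp
    qed auto
  qed
  also have "\<dots> = (\<Sum>n. \<integral>\<^sup>+x. ennreal (?f n x) \<partial>lborel)"
    by (rule nn_integral_suminf) auto
  also have "(\<lambda>n. \<integral>\<^sup>+x. ennreal (?f n x) \<partial>lborel) =
             (\<lambda>n. ennreal ((2 * pi) powr (s - 1) * (2 * K) * real (Suc n) powr (s - 1)))"
  proof
    fix n
    have "(\<integral>\<^sup>+x. ennreal (?f n x) \<partial>lborel) = \<bar>b n\<bar> * (\<integral>\<^sup>+x. ennreal (?f n (0 + b n * x)) \<partial>lborel)"
      using b[of n] by (intro nn_integral_real_affine) auto
    also have "(\<integral>\<^sup>+x. ennreal (?f n (0 + b n * x)) \<partial>lborel) =
       (\<integral>\<^sup>+x. ennreal (2 * b n powr (s - 2)) * ennreal (indicator {0<..} x * (x powr s / (1 + x\<^sup>2))) \<partial>lborel)"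
    proof (intro nn_integral_cong)
      fix x :: real
      show "ennreal (?f n (0 + b n * x)) =
            ennreal (2 * b n powr (s - 2)) * ennreal (indicator {0<..} x * (x powr s / (1 + x\<^sup>2)))"
      proof (cases "x > 0")
        case True
        have "(b n * x)\<^sup>2 + (b n)\<^sup>2 = (b n)\<^sup>2 * (1 + x\<^sup>2)" by (simp add: power_mult_distrib algebra_simps)
        moreover have "(b n * x) powr (s - 1) = b n powr s / b n * (x powr s / x)"
          using True b[of n] by (simp add: powr_mult powr_diff)
        moreover have "b n powr (s - 2) = b n powr s / (b n)\<^sup>2"
          using b[of n] by (simp add: powr_diff)
        ultimately have "2 * (b n * x) / ((b n * x)\<^sup>2 + (b n)\<^sup>2) * (b n * x) powr (s - 1) =
                         2 * b n powr (s - 2) * (x powr s / (1 + x\<^sup>2))"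
          using True b[of n] by simp
        thus ?thesis using True b[of n] by (simp add: ennreal_mult[symmetric])
      next
        case False
        thus ?thesis using b[of n] by (auto simp: indicator_def zero_less_mult_iff)
      qed
    qed
    also have "\<dots> = ennreal (2 * b n powr (s - 2)) * ennreal K"
      using s unfolding K_def by (subst nn_integral_cmult, simp, subst nn_integral_powr_over_1_plus_square) auto
    also have "ennreal \<bar>b n\<bar> * (ennreal (2 * b n powr (s - 2)) * ennreal K) =
               ennreal (b n * (2 * b n powr (s - 2) * K))"
      using b[of n] K by (simp add: ennreal_mult[symmetric])
    also have "b n * (2 * b n powr (s - 2) * K) = 2 * K * b n powr (s - 1)"
      using b[of n] by (simp add: powr_diff power2_eq_square)
    also have "b n powr (s - 1) = (2 * pi) powr (s - 1) * real (Suc n) powr (s - 1)"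
      by (simp add: b_def powr_mult del: of_nat_Suc)
    finally show "(\<integral>\<^sup>+x. ennreal (?f n x) \<partial>lborel) =
        ennreal ((2 * pi) powr (s - 1) * (2 * K) * real (Suc n) powr (s - 1))"
      by (simp add: mult_ac)
  qed
  also have "(\<Sum>n. ennreal ((2 * pi) powr (s - 1) * (2 * K) * real (Suc n) powr (s - 1))) =
             ennreal ((2 * pi) powr (s - 1) * (2 * K) * (\<Sum>n. real (Suc n) powr (s - 1)))"
  proof (rule suminf_ennreal_eq)
    have "summable (\<lambda>n. real n powr (s - 1))" using s by (simp add: summable_real_powr_iff)
    hence "summable (\<lambda>n. real (Suc n) powr (s - 1))" by (subst summable_Suc_iff)
    thus "(\<lambda>n. (2 * pi) powr (s - 1) * (2 * K) * real (Suc n) powr (s - 1)) sums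
            ((2 * pi) powr (s - 1) * (2 * K) * (\<Sum>n. real (Suc n) powr (s - 1)))"
      by (intro sums_mult summable_sums)
  qed (use K in auto)
  finally show ?thesis by (simp add: K_def)
qed

section \<open>The Mellin integral split at 1\<close>

lemma nn_integral_powr_0_1:
  assumes "p > (-1::real)"
  shows "(\<integral>\<^sup>+x. ennreal (indicator {0<..1} x * x powr p) \<partial>lborel) = ennreal (1 / (p + 1))"
proof -
  have "(\<integral>\<^sup>+x. ennreal (indicator {0..1} x * x powr p) \<partial>lborel) = ennreal (1 powr (p + 1) / (p + 1))"
    using has_integral_powr_from_0[OF assms, of 1] by (intro nn_integral_has_integral_lebesgue) auto
  also have "(\<lambda>x. ennreal (indicator {0..1} x * x powr p)) = (\<lambda>x. ennreal (indicator {0<..1} x * x powr p))"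
    by (auto simp: indicator_def fun_eq_iff)
  finally show ?thesis by simp
qed

lemma set_integral_powr_0_1:
  assumes "p > (-1::real)"
  shows "set_integrable lborel {0<..1} (\<lambda>x. x powr p)" "(LINT x:{0<..1}|lborel. x powr p) = 1 / (p + 1)"
  by (rule set_integral_nonnegI; use assms nn_integral_powr_0_1[OF assms] in simp)+

lemma nn_integral_powr_1_inf:
  assumes "p < (-1::real)"
  shows "(\<integral>\<^sup>+x. ennreal (indicator {1<..} x * x powr p) \<partial>lborel) = ennreal (- 1 / (p + 1))"
proof -
  have "(\<integral>\<^sup>+x. ennreal (indicator {1..} x * x powr p) \<partial>lborel) = ennreal (- (1 powr (p + 1)) / (p + 1))"
    using has_integral_powr_to_inf[OF assms, of 1] by (intro nn_integral_has_integral_lebesgue) auto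
  also have "(\<integral>\<^sup>+x. ennreal (indicator {1..} x * x powr p) \<partial>lborel) =
             (\<integral>\<^sup>+x. ennreal (indicator {1<..} x * x powr p) \<partial>lborel)"
    by (intro nn_integral_cong_AE eventually_mono[OF AE_lborel_singleton[of "1::real"]])
       (auto simp: indicator_def)
  finally show ?thesis by simp
qed

lemma set_integral_powr_1_inf:
  assumes "p < (-1::real)"
  shows "set_integrable lborel {1<..} (\<lambda>x. x powr p)" "(LINT x:{1<..}|lborel. x powr p) = - 1 / (p + 1)"
  by (rule set_integral_nonnegI; use assms nn_integral_powr_1_inf[OF assms] in \<open>simp add: divide_nonneg_neg\<close>)+

lemma set_integrable_bose_tail:
  assumes "\<sigma> > -1"
  shows "set_integrable lborel {0<..1} (\<lambda>x. bose_tail x * x powr (\<sigma> - 1))"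
proof (rule set_integrable_bound[OF set_integral_powr_0_1(1)[OF assms]])
  show "AE x in lborel. x \<in> {0<..1} \<longrightarrow> norm (bose_tail x * x powr (\<sigma> - 1)) \<le> norm (x powr \<sigma>)"
  proof (intro AE_I2 impI)
    fix x :: real assume x: "x \<in> {0<..1}"
    have "bose_tail x * x powr (\<sigma> - 1) \<le> x * x powr (\<sigma> - 1)"
      using bose_tail_le[of x] x by (intro mult_right_mono) auto
    also have "x * x powr (\<sigma> - 1) = x powr \<sigma>" using x by (simp add: powr_diff)
    finally show "norm (bose_tail x * x powr (\<sigma> - 1)) \<le> norm (x powr \<sigma>)"
      using bose_tail_nonneg[of x] x by simp
  qed
qed (simp add: set_borel_measurable_def)

text \<open>Exponential decay beats every power, so this piece converges for all real exponents and
  its transform is entire.\<close>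

lemma set_integrable_bose:
  "set_integrable lborel {1<..} (\<lambda>x. 1 / (exp x - 1) * x powr (\<sigma> - 1 :: real))"
proof -
  \<comment> \<open>The exponent \<open>abs sigma + 1\<close> is positive, as the Gamma integral
    demands, and at least sigma, so it dominates on x > 1.\<close>
  have "set_integrable lborel {0<..} (\<lambda>x. x powr (\<bar>\<sigma>\<bar> + 1 - 1) * exp (- (1 * x)))"
    by (rule set_integral_nonnegI)
       (use nn_integral_Gamma_scaled[of "\<bar>\<sigma>\<bar> + 1" 1] in \<open>auto intro!: Gamma_real_nonneg\<close>)
  hence "set_integrable lborel {1<..} (\<lambda>x. 2 * (x powr (\<bar>\<sigma>\<bar> + 1 - 1) * exp (- (1 * x))))"
    by (intro set_integrable_mult_right) (auto elim!: set_integrable_subset)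
  thus ?thesis
  proof (rule set_integrable_bound)
    show "AE x in lborel. x \<in> {1<..} \<longrightarrow> norm (1 / (exp x - 1) * x powr (\<sigma> - 1)) \<le>
            norm (2 * (x powr (\<bar>\<sigma>\<bar> + 1 - 1) * exp (- (1 * x))))"
    proof (intro AE_I2 impI)
      fix x :: real assume x: "x \<in> {1<..}"
      have "exp x \<ge> 2" using exp_ge_add_one_self[of x] x unfolding greaterThan_iff by linarith
      hence "1 / (exp x - 1) \<le> 1 / (exp x / 2)" by (intro frac_le) auto
      also have "1 / (exp x / 2) = 2 * exp (-x)" by (simp add: exp_minus field_simps)
      finally have "1 / (exp x - 1) \<le> 2 * exp (-x)" .
      moreover have "x powr (\<sigma> - 1) \<le> x powr \<bar>\<sigma>\<bar>" using x by (intro powr_mono) auto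
      ultimately have "1 / (exp x - 1) * x powr (\<sigma> - 1) \<le> 2 * exp (-x) * x powr \<bar>\<sigma>\<bar>"
        by (intro mult_mono) auto
      thus "norm (1 / (exp x - 1) * x powr (\<sigma> - 1)) \<le> norm (2 * (x powr (\<bar>\<sigma>\<bar> + 1 - 1) * exp (- (1 * x))))"
        using \<open>exp x \<ge> 2\<close> by (simp add: mult_ac)
    qed
  qed (simp add: set_borel_measurable_def)
qed

text \<open>
  The analytic continuation of \<open>Gamma s * zeta s\<close> to \<open>Re s > -1\<close>, restricted to real arguments.
\<close>

definition mellin_bose_real :: "real \<Rightarrow> real" where
  "mellin_bose_real s = (LINT x:{0<..1}|lborel. bose_tail x * x powr (s - 1)) +
     (LINT x:{1<..}|lborel. 1 / (exp x - 1) * x powr (s - 1)) + 1 / (s - 1) - 1 / (2 * s)"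

text \<open>For s > 1 the subtracted \<open>1 / x - 1 / 2\<close> can be integrated separately over
  (0, 1], and contributes exactly the two rational terms.\<close>

lemma mellin_bose_real_gt_1:
  assumes s: "s > 1"
  shows "mellin_bose_real s = Gamma s * (\<Sum>n. real (Suc n) powr (-s))"
proof -
  let ?f = "\<lambda>x. 1 / (exp x - 1) * x powr (s - 1)"
  have Z: "(\<Sum>n. real (Suc n) powr (-s)) \<ge> 0"
  proof (rule suminf_nonneg)
    have "summable (\<lambda>n. real n powr (-s))" using s by (simp add: summable_real_powr_iff)
    thus "summable (\<lambda>n. real (Suc n) powr (-s))" by (subst summable_Suc_iff)
  qed auto
  have f: "set_integrable lborel {0<..} ?f"
    "(LINT x:{0<..}|lborel. ?f x) = Gamma s * (\<Sum>n. real (Suc n) powr (-s))"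
    by (rule set_integral_nonnegI; use s Z nn_integral_bose[OF s] in \<open>simp add: Gamma_real_nonneg\<close>)+
  have "{0<..} = {0<..1} \<union> {1::real<..}" "{0<..1} \<inter> {1::real<..} = {}" by auto
  hence "(LINT x:{0<..}|lborel. ?f x) = (LINT x:{0<..1}|lborel. ?f x) + (LINT x:{1<..}|lborel. ?f x)"
    using set_integral_Un[of "{0<..1}" "{1<..}" lborel ?f] set_integrable_subset[OF f(1)] by simp
  also have "(LINT x:{0<..1}|lborel. ?f x) = (LINT x:{0<..1}|lborel.
      bose_tail x * x powr (s - 1) + x powr (s - 2) - 1 / 2 * x powr (s - 1))"
  proof (intro set_lebesgue_integral_cong allI impI)
    fix x :: real assume x: "x \<in> {0<..1}"
    have "x powr (s - 2) = 1 / x * x powr (s - 1)"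
      using x by (simp add: powr_diff power2_eq_square)
    thus "?f x = bose_tail x * x powr (s - 1) + x powr (s - 2) - 1 / 2 * x powr (s - 1)"
      unfolding bose_tail_def by (simp only:) (simp add: algebra_simps)
  qed auto
  also have "\<dots> = (LINT x:{0<..1}|lborel. bose_tail x * x powr (s - 1)) + 1 / (s - 1) - 1 / (2 * s)"
    using s set_integral_powr_0_1[of "s - 2"] set_integral_powr_0_1[of "s - 1"] set_integrable_bose_tail[of s]
    by (subst set_integral_diff set_integral_add | simp)+
  finally show ?thesis using f(2) by (simp add: mellin_bose_real_def)
qed

text \<open>For s < 0 the same two rational terms arise on (1, inf) instead, from integrating
  \<open>- 1 / x + 1 / 2\<close>; hence one expression represents both integrals.\<close>

lemma mellin_bose_real_neg:
  assumes s: "-1 < s" "s < 0"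
  shows "mellin_bose_real s = (2 * pi) powr (s - 1) * (pi / sin (pi * ((s + 1) / 2))) *
           (\<Sum>n. real (Suc n) powr (s - 1))"
proof -
  let ?f = "\<lambda>x. bose_tail x * x powr (s - 1)"
  have Z: "(\<Sum>n. real (Suc n) powr (s - 1)) \<ge> 0"
  proof (rule suminf_nonneg)
    have "summable (\<lambda>n. real n powr (s - 1))" using s by (simp add: summable_real_powr_iff)
    thus "summable (\<lambda>n. real (Suc n) powr (s - 1))" by (subst summable_Suc_iff)
  qed auto
  have "sin (pi * ((s + 1) / 2)) > 0" using s by (intro sin_gt_zero) auto
  hence nonneg: "(2 * pi) powr (s - 1) * (pi / sin (pi * ((s + 1) / 2))) *
           (\<Sum>n. real (Suc n) powr (s - 1)) \<ge> 0" (is "?R \<ge> 0")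
    using Z by (intro mult_nonneg_nonneg divide_nonneg_nonneg) auto
  have f: "set_integrable lborel {0<..} ?f" "(LINT x:{0<..}|lborel. ?f x) = ?R"
    by (rule set_integral_nonnegI; use bose_tail_nonneg nonneg nn_integral_bose_tail[OF s] in simp)+
  have "{0<..} = {0<..1} \<union> {1::real<..}" "{0<..1} \<inter> {1::real<..} = {}" by auto
  hence "(LINT x:{0<..}|lborel. ?f x) = (LINT x:{0<..1}|lborel. ?f x) + (LINT x:{1<..}|lborel. ?f x)"
    using set_integral_Un[of "{0<..1}" "{1<..}" lborel ?f] set_integrable_subset[OF f(1)] by simp
  also have "(LINT x:{1<..}|lborel. ?f x) = (LINT x:{1<..}|lborel.
      1 / (exp x - 1) * x powr (s - 1) - x powr (s - 2) + 1 / 2 * x powr (s - 1))"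
  proof (intro set_lebesgue_integral_cong allI impI)
    fix x :: real assume x: "x \<in> {1<..}"
    have "x powr (s - 2) = 1 / x * x powr (s - 1)"
      using x by (simp add: powr_diff power2_eq_square)
    thus "?f x = 1 / (exp x - 1) * x powr (s - 1) - x powr (s - 2) + 1 / 2 * x powr (s - 1)"
      unfolding bose_tail_def by (simp only:) (simp add: algebra_simps)
  qed auto
  also have "\<dots> = (LINT x:{1<..}|lborel. 1 / (exp x - 1) * x powr (s - 1)) + 1 / (s - 1) - 1 / (2 * s)"
    using s set_integral_powr_1_inf[of "s - 2"] set_integral_powr_1_inf[of "s - 1"] set_integrable_bose[of s]
    by (subst set_integral_diff set_integral_add | simp)+
  finally show ?thesis using f(2) by (simp add: mellin_bose_real_def)
qed

section \<open>Continuation of the Dirichlet series\<close>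

text \<open>The midpoint of the interval is a limit point of it. This carries the real identities
  between Mellin integrals over to complex arguments.\<close>

lemma identity_theorem_real:
  fixes f g :: "complex \<Rightarrow> complex"
  assumes "f holomorphic_on S" "g holomorphic_on S" "open S" "connected S"
    and "a < b" and sub: "\<And>x. a < x \<Longrightarrow> x < b \<Longrightarrow> of_real x \<in> S"
    and eq: "\<And>x. a < x \<Longrightarrow> x < b \<Longrightarrow> f (of_real x) = g (of_real x)"
    and "s \<in> S"
  shows "f s = g s"
proof -
  define m where "m = (a + b) / 2"
  have m: "a < m" "m < b" using \<open>a < b\<close> by (auto simp: m_def)
  have lim: "complex_of_real m islimpt complex_of_real ` {a<..<b}"
    unfolding islimpt_approachable
  proof (intro allI impI)
    fix e :: real assume e: "e > 0"
    \<comment> \<open>Positive, below \<open>e\<close> and below \<open>b - m\<close>: the point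
      \<open>m + d\<close> differs from \<open>m\<close> and stays in the interval.\<close>
    define d where "d = min (e / 2) ((b - m) / 2)"
    define x where "x = m + d"
    have "d > 0" unfolding d_def using m e by simp
    moreover have "d < e" "d < b - m" unfolding d_def using m e by (simp_all add: min_less_iff_disj)
    ultimately have "a < x" "x < b" "x \<noteq> m" "\<bar>x - m\<bar> < e" using m by (simp_all add: x_def)
    thus "\<exists>x'\<in>complex_of_real ` {a<..<b}. x' \<noteq> of_real m \<and> dist x' (of_real m) < e"
      by (intro bexI[of _ "of_real x"]) (simp_all add: dist_of_real dist_real_def)
  qed
  have hol: "(\<lambda>z. f z - g z) holomorphic_on S"
    using assms(1,2) by (rule holomorphic_on_diff)
  have "f s - g s = 0"
  proof (rule analytic_continuation[OF hol])
    show "f z - g z = 0" if "z \<in> complex_of_real ` {a<..<b}" for z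
      using that eq by auto
    show "complex_of_real m \<in> S" by (intro sub m)
    show "complex_of_real ` {a<..<b} \<subseteq> S" using sub by auto
  qed fact+
  thus ?thesis by simp
qed

section \<open>The Dirichlet series in its half-plane of convergence\<close>

definition dirichlet_zeta :: "complex \<Rightarrow> complex" where
  "dirichlet_zeta s = (\<Sum>n. of_nat (Suc n) powr -s)"

lemma norm_of_nat_powr: "n > 0 \<Longrightarrow> cmod (of_nat n powr s) = real n powr Re s"
  using norm_powr_real_powr[of "real n" s] by simp

lemma summable_nat_powr:
  assumes "\<sigma> > 1"
  shows "summable (\<lambda>n. real (Suc n) powr - \<sigma>)"
proof -
  have "summable (\<lambda>n. real n powr (-\<sigma>))" using assms by (simp add: summable_real_powr_iff)
  thus ?thesis by (subst summable_Suc_iff)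
qed

lemma dirichlet_zeta_sums:
  assumes "Re s > 1"
  shows "(\<lambda>n. of_nat (Suc n) powr -s) sums dirichlet_zeta s"
proof -
  have "summable (\<lambda>n. norm (of_nat (Suc n) powr -s))"
    using summable_nat_powr[OF assms] by (simp add: norm_of_nat_powr del: of_nat_Suc)
  from summable_norm_cancel[OF this] show ?thesis
    unfolding dirichlet_zeta_def by (rule summable_sums)
qed

lemma dirichlet_zeta_of_real:
  assumes "s > 1"
  shows "dirichlet_zeta (of_real s) = of_real (\<Sum>n. real (Suc n) powr -s)"
proof -
  have "(\<lambda>n. complex_of_real (real (Suc n) powr -s)) sums of_real (\<Sum>n. real (Suc n) powr -s)"
    using summable_nat_powr[OF assms] by (intro sums_of_real summable_sums)
  also have "(\<lambda>n. complex_of_real (real (Suc n) powr -s)) = (\<lambda>n. of_nat (Suc n) powr - of_real s)"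
    by (simp add: powr_of_real[symmetric] del: of_nat_Suc)
  finally show ?thesis
    using dirichlet_zeta_sums[of "of_real s"] assms by (auto intro: sums_unique2)
qed

lemma dirichlet_zeta_holomorphic: "dirichlet_zeta holomorphic_on {s. Re s > 1}"
proof -
  have "\<exists>g. \<forall>s\<in>{s. Re s > 1}. (\<lambda>n. of_nat (Suc n) powr -s) sums g s \<and> g field_differentiable (at s)"
  proof (rule series_differentiable_comparison_complex)
    show "open {s. Re s > 1}" by (rule open_halfspace_Re_gt)
    show "(\<lambda>s. of_nat (Suc n) powr -s) field_differentiable (at s)" for n and s :: complex
    proof -
      define c where "c = ln (complex_of_nat (Suc n))"
      have eq: "(\<lambda>s. complex_of_nat (Suc n) powr -s) = (\<lambda>s. exp (- (s * c)))"
        unfolding powr_def c_def by (simp only: of_nat_eq_0_iff nat.simps if_False mult_minus_left)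
      have "((\<lambda>s. exp (- (s * c))) has_field_derivative exp (- (s * c)) * (- c)) (at s)"
        by (auto intro!: derivative_eq_intros)
      thus ?thesis unfolding eq field_differentiable_def by blast
    qed
    fix s assume s: "s \<in> {s. Re s > 1}"
    \<comment> \<open>The midpoint of 1 and \<open>Re s\<close>: on the ball of radius
      \<open>Re s - sigma\<close> real parts stay above sigma, so \<open>n powr - sigma\<close> is a
      summable majorant.\<close>
    define \<sigma> where "\<sigma> = (Re s + 1) / 2"
    have \<sigma>: "\<sigma> > 1" "\<sigma> < Re s" using s by (auto simp: \<sigma>_def)
    let ?h = "\<lambda>n. complex_of_real (real (Suc n) powr - \<sigma>)"
    have "summable ?h" by (subst summable_of_real_iff) (rule summable_nat_powr[OF \<sigma>(1)])
    moreover have "\<forall>\<^sub>F n in sequentially. \<forall>y\<in>ball s (Re s - \<sigma>) \<inter> {s. 1 < Re s}.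
        cmod (of_nat (Suc n) powr - y) \<le> cmod (?h n)"
    proof (intro always_eventually allI ballI)
      fix n y assume y: "y \<in> ball s (Re s - \<sigma>) \<inter> {s. 1 < Re s}"
      have "\<bar>Re (s - y)\<bar> \<le> cmod (s - y)" by (rule abs_Re_le_cmod)
      hence "Re y \<ge> \<sigma>" using y unfolding Int_iff mem_ball dist_norm minus_complex.simps by linarith
      thus "cmod (of_nat (Suc n) powr - y) \<le> cmod (?h n)"
        unfolding norm_of_nat_powr[OF zero_less_Suc] by (simp add: powr_mono)
    qed
    ultimately show "\<exists>d h. 0 < d \<and> summable h \<and> range h \<subseteq> \<real>\<^sub>\<ge>\<^sub>0 \<and>
        (\<forall>\<^sub>F n in sequentially. \<forall>y\<in>ball s d \<inter> {s. 1 < Re s}. cmod (of_nat (Suc n) powr - y) \<le> cmod (h n))"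
      using \<sigma> by (intro exI[of _ "Re s - \<sigma>"] exI[of _ ?h]) auto
  qed auto
  then obtain g where g: "\<And>s. Re s > 1 \<Longrightarrow> (\<lambda>n. of_nat (Suc n) powr -s) sums g s"
      "\<And>s. Re s > 1 \<Longrightarrow> g field_differentiable (at s)" by auto
  have "g holomorphic_on {s. Re s > 1}"
    using g(2) by (auto simp: holomorphic_on_def field_differentiable_at_within)
  moreover have "g s = dirichlet_zeta s" if "Re s > 1" for s
    using g(1)[OF that] dirichlet_zeta_sums[OF that] by (rule sums_unique2)
  ultimately show ?thesis by (subst holomorphic_cong[OF refl, of _ _ g]) auto
qed

text \<open>The rational terms of \<open>mellin_bose_real\<close> are left out, so that this is
  holomorphic throughout \<open>Re s > -1\<close>.\<close>

definition mellin_bose :: "complex \<Rightarrow> complex" where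
  "mellin_bose s = mellin {0<..1} bose_tail s + mellin {1<..} (\<lambda>x. 1 / (exp x - 1)) s"

text \<open>
  The pole of \<^const>\<open>mellin_bose_real\<close> at 0 is absorbed into \<open>rGamma\<close> by \<open>rGamma s / s = rGamma (s + 1)\<close>.
\<close>

definition zeta_right :: "complex \<Rightarrow> complex" where
  "zeta_right s = rGamma s * (mellin_bose s + 1 / (s - 1)) - rGamma (s + 1) / 2"

text \<open>The right-hand side of the functional equation with the series itself in place of its
  continuation; it makes sense for \<open>Re s < 0\<close>.\<close>

definition zeta_left :: "complex \<Rightarrow> complex" where
  "zeta_left s = 2 * of_real (2 * pi) powr (s - 1) * Gamma (1 - s) * sin (of_real pi * s / 2) *
     dirichlet_zeta (1 - s)"

lemma mellin_bose_holomorphic: "mellin_bose holomorphic_on {s. Re s > -1}"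
proof -
  have "mellin {0<..1} bose_tail holomorphic_on {s. Re s \<in> {-1<..}}"
    by (rule mellin_holomorphic) (auto intro: set_integrable_bose_tail)
  moreover have "mellin {1<..} (\<lambda>x. 1 / (exp x - 1)) holomorphic_on {s. Re s \<in> UNIV}"
    by (rule mellin_holomorphic) (auto intro!: set_integrable_bose[simplified])
  ultimately show ?thesis
    unfolding mellin_bose_def by (intro holomorphic_intros) (auto elim: holomorphic_on_subset)
qed

lemma zeta_right_holomorphic: "zeta_right holomorphic_on {s. Re s > -1} - {1}"
  unfolding zeta_right_def
  by (intro holomorphic_intros holomorphic_on_subset[OF mellin_bose_holomorphic]) auto

lemma zeta_left_holomorphic: "zeta_left holomorphic_on {s. Re s < 0}"
proof -
  have "(dirichlet_zeta \<circ> (\<lambda>s. 1 - s)) holomorphic_on {s. Re s < 0}"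
    by (intro holomorphic_on_compose_gen[OF _ dirichlet_zeta_holomorphic] holomorphic_intros) auto
  moreover have "1 - s \<notin> \<int>\<^sub>\<le>\<^sub>0" if "Re s < 0" for s
    using that by (auto elim!: nonpos_Ints_cases simp: complex_eq_iff)
  ultimately show ?thesis
    unfolding zeta_left_def o_def by (intro holomorphic_intros) auto
qed

lemma zeta_right_of_real:
  assumes "s \<noteq> 0"
  shows "zeta_right (of_real s) = of_real (rGamma s * mellin_bose_real s)"
proof -
  have 1: "rGamma (complex_of_real s + 1) = of_real (rGamma s / s)"
    using assms rGamma_plus1[of "complex_of_real s"] by (simp add: rGamma_complex_of_real field_simps)
  have 2: "mellin_bose (of_real s) = of_real (LINT x:{0<..1}|lborel. bose_tail x * x powr (s - 1)) +
     of_real (LINT x:{1<..}|lborel. 1 / (exp x - 1) * x powr (s - 1))"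
    unfolding mellin_bose_def by (subst (1 2) mellin_of_real) auto
  show ?thesis
    unfolding zeta_right_def 1 2 mellin_bose_real_def
    by (simp add: rGamma_complex_of_real ring_distribs)
qed

text \<open>By the identity theorem the interval (1, 2) suffices; there \<open>rGamma\<close>
  cancels the Gamma factor of \<open>mellin_bose_real_gt_1\<close>.\<close>

lemma zeta_right_eq_dirichlet:
  assumes "Re s > 1"
  shows "zeta_right s = dirichlet_zeta s"
proof (rule identity_theorem_real[where f = zeta_right and g = dirichlet_zeta and S = "{s. Re s > 1}" and a = 1 and b = 2])
  show "zeta_right holomorphic_on {s. Re s > 1}"
    by (rule holomorphic_on_subset[OF zeta_right_holomorphic]) auto
  show "zeta_right (of_real x) = dirichlet_zeta (of_real x)" if "1 < x" "x < 2" for x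
  proof -
    have "Gamma x > 0" using that by (intro Gamma_real_pos) linarith
    hence "rGamma x * Gamma x = 1" by (simp add: rGamma_inverse_Gamma)
    hence "rGamma x * mellin_bose_real x = (\<Sum>n. real (Suc n) powr (-x))"
      unfolding mellin_bose_real_gt_1[OF that(1)] mult.assoc[symmetric] by simp
    thus ?thesis using zeta_right_of_real[of x] dirichlet_zeta_of_real[OF that(1)] that by simp
  qed
qed (use assms in \<open>simp_all add: dirichlet_zeta_holomorphic open_halfspace_Re_gt convex_halfspace_Re_gt convex_connected\<close>)

text \<open>On the interval (-1, 0) the denominator in \<open>mellin_bose_real_neg\<close> is
  \<open>cos (pi * x / 2)\<close>. Gamma reflection and
  \<open>sin (pi * x) = 2 * sin (pi * x / 2) * cos (pi * x / 2)\<close> turn \<open>rGamma x\<close>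
  divided by it into a multiple of \<open>Gamma (1 - x) * sin (pi * x / 2)\<close>.\<close>

lemma zeta_right_eq_left:
  assumes "-1 < Re s" "Re s < 0"
  shows "zeta_right s = zeta_left s"
proof (rule identity_theorem_real[where f = zeta_right and g = zeta_left and S = "{s. Re s > -1} \<inter> {s. Re s < 0}" and a = "-1" and b = 0])
  show "zeta_right holomorphic_on {s. Re s > -1} \<inter> {s. Re s < 0}"
    by (rule holomorphic_on_subset[OF zeta_right_holomorphic]) auto
  show "zeta_left holomorphic_on {s. Re s > -1} \<inter> {s. Re s < 0}"
    by (rule holomorphic_on_subset[OF zeta_left_holomorphic]) auto
  show "open ({s. Re s > -1} \<inter> {s. Re s < 0})"
    by (intro open_Int open_halfspace_Re_gt open_halfspace_Re_lt)
  show "connected ({s. Re s > -1} \<inter> {s. Re s < 0})"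
    by (intro convex_connected convex_Int convex_halfspace_Re_gt convex_halfspace_Re_lt)
  fix x :: real assume x: "-1 < x" "x < 0"
  define c where "c = cos (pi * x / 2)"
  define d where "d = sin (pi * x / 2)"
  have px: "- pi < pi * x" "pi * x < 0"
    using mult_strict_left_mono[OF x(1) pi_gt_zero] mult_strict_left_mono[OF x(2) pi_gt_zero] by simp_all
  have "c > 0" unfolding c_def by (intro cos_gt_zero_pi) (use px in linarith)+
  have "sin (- (pi * x / 2)) > 0" by (intro sin_gt_zero) (use px in linarith)+
  hence "d < 0" by (simp add: d_def)
  have "pi * ((x + 1) / 2) = pi / 2 - - (pi * x / 2)" by (simp add: field_simps)
  hence s1: "sin (pi * ((x + 1) / 2)) = c"
    by (simp only: sin_cos_eq c_def) simp
  have s2: "sin (pi * x) = 2 * d * c"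
    using sin_double[of "pi * x / 2"] by (simp add: c_def d_def)
  have "Gamma x * (2 * Gamma (1 - x) * d * c / pi) = (Gamma x * Gamma (1 - x)) * (2 * d * c / pi)"
    by simp
  also have "\<dots> = pi / (2 * d * c) * (2 * d * c / pi)"
    by (simp only: Gamma_reflection_real s2)
  also have "\<dots> = 1" using \<open>c > 0\<close> \<open>d < 0\<close> by simp
  finally have "rGamma x = 2 * Gamma (1 - x) * d * c / pi"
    unfolding rGamma_inverse_Gamma by (rule inverse_unique)
  hence r: "rGamma x * (pi / c) = 2 * Gamma (1 - x) * d"
    using \<open>c > 0\<close> by simp
  have "rGamma x * mellin_bose_real x = (rGamma x * (pi / c)) * (2 * pi) powr (x - 1) *
            (\<Sum>n. real (Suc n) powr (x - 1))"
    unfolding mellin_bose_real_neg[OF x] s1 by (simp only: mult_ac)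
  also have "\<dots> = 2 * (2 * pi) powr (x - 1) * Gamma (1 - x) * d * (\<Sum>n. real (Suc n) powr (x - 1))"
    unfolding r by (simp only: mult_ac)
  finally have "rGamma x * mellin_bose_real x = \<dots>" .
  moreover have "zeta_left (of_real x) = of_real (2 * (2 * pi) powr (x - 1) * Gamma (1 - x) * d *
            (\<Sum>n. real (Suc n) powr (x - 1)))"
  proof -
    have eqs: "1 - complex_of_real x = of_real (1 - x)" "complex_of_real x - 1 = of_real (x - 1)"
      "complex_of_real pi * of_real x / 2 = of_real (pi * x / 2)" by simp_all
    have "dirichlet_zeta (of_real (1 - x)) = of_real (\<Sum>n. real (Suc n) powr (x - 1))"
      using dirichlet_zeta_of_real[of "1 - x"] x by (simp del: of_real_diff)
    moreover have "complex_of_real (2 * pi) powr of_real (x - 1) = of_real ((2 * pi) powr (x - 1))"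
      by (rule powr_of_real) simp
    ultimately show ?thesis
      unfolding zeta_left_def eqs Gamma_complex_of_real sin_of_real d_def
      by (simp only: of_real_mult of_real_numeral)
  qed
  ultimately show "zeta_right (of_real x) = zeta_left (of_real x)"
    using zeta_right_of_real[of x] x by simp
qed (use assms in simp_all)

section \<open>The functional equation\<close>

text \<open>The value 0 at 1 is the one that \<open>nicely_meromorphic_on\<close> prescribes at a
  pole. On the overlap of the two half-planes the formulas agree by
  \<open>zeta_right_eq_left\<close>.\<close>

definition zeta_cont :: "complex \<Rightarrow> complex" where
  "zeta_cont s = (if s = 1 then 0 else if Re s > -1 then zeta_right s else zeta_left s)"

lemma zeta_cont_right: "Re s > -1 \<Longrightarrow> s \<noteq> 1 \<Longrightarrow> zeta_cont s = zeta_right s"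
  by (simp add: zeta_cont_def)

lemma zeta_cont_left: "Re s < 0 \<Longrightarrow> zeta_cont s = zeta_left s"
  by (cases "s = 1") (simp_all add: zeta_cont_def zeta_right_eq_left)

lemma zeta_cont_holomorphic: "zeta_cont holomorphic_on - {1}"
proof -
  have "zeta_cont holomorphic_on ({s. Re s > -1} - {1})"
    using zeta_right_holomorphic by (rule holomorphic_transform) (simp add: zeta_cont_right)
  moreover have "zeta_cont holomorphic_on {s. Re s < 0}"
    using zeta_left_holomorphic by (rule holomorphic_transform) (simp add: zeta_cont_left)
  ultimately have "zeta_cont holomorphic_on ({s. Re s > -1} - {1}) \<union> {s. Re s < 0}"
    by (rule holomorphic_on_Un) (simp_all add: open_halfspace_Re_gt open_halfspace_Re_lt open_delete)
  also have "({s. Re s > -1} - {1}) \<union> {s. Re s < 0} = - {1::complex}"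
    by auto
  finally show ?thesis .
qed

text \<open>Separates the polar part at 1, from which both the pole and the residue
  \<open>rGamma 1 = 1\<close> are read off.\<close>

lemma zeta_cont_near_1:
  obtains h where "isCont h 1" "\<forall>\<^sub>F s in at 1. zeta_cont s = rGamma s / (s - 1) + h s"
proof
  let ?h = "\<lambda>s. rGamma s * mellin_bose s - rGamma (s + 1) / 2"
  have "?h holomorphic_on {s. Re s > -1}"
    by (intro holomorphic_intros mellin_bose_holomorphic) simp_all
  thus "isCont ?h 1"
    by (rule continuous_on_interior[OF holomorphic_on_imp_continuous_on])
       (simp add: interior_open open_halfspace_Re_gt)
  have "\<forall>\<^sub>F s in at 1. s \<in> {s. Re s > -1} - {1}"
    by (rule eventually_at_in_open) (simp_all add: open_halfspace_Re_gt)
  thus "\<forall>\<^sub>F s in at 1. zeta_cont s = rGamma s / (s - 1) + ?h s"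
    by eventually_elim (simp add: zeta_cont_right zeta_right_def algebra_simps)
qed

lemma is_pole_zeta_cont: "is_pole zeta_cont 1"
proof -
  obtain h where "isCont h 1" and eq: "\<forall>\<^sub>F s in at 1. zeta_cont s = rGamma s / (s - 1) + h s"
    by (rule zeta_cont_near_1)
  hence h: "h \<midarrow>1\<rightarrow> h 1" by (simp add: isCont_def)
  have "is_pole (\<lambda>s. rGamma s / (s - 1)) (1::complex)"
  proof (rule is_pole_divide)
    show "isCont rGamma (1::complex)" by (intro isCont_rGamma) simp
    show "filterlim (\<lambda>s. s - 1) (at 0) (at (1::complex))"
      by (rule filterlim_atI) (auto intro!: tendsto_eq_intros eventually_neq_at_within)
  qed simp
  hence "filterlim (\<lambda>s. rGamma s / (s - 1) + h s) at_infinity (at (1::complex))"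
    unfolding is_pole_def using h by (rule tendsto_add_filterlim_at_infinity')
  thus ?thesis
    unfolding is_pole_def by (subst filterlim_cong[OF refl refl eq])
qed

lemma is_zeta_zeta_cont: "is_zeta zeta_cont"
proof -
  have analytic: "zeta_cont analytic_on - {1}"
    using zeta_cont_holomorphic by (subst analytic_on_open) auto
  have "zeta_cont meromorphic_on {1}"
    unfolding meromorphic_at_iff
  proof
    show "isolated_singularity_at zeta_cont 1"
      unfolding isolated_singularity_at_def
      by (intro exI[of _ 1] conjI analytic_on_subset[OF analytic]) auto
    show "not_essential zeta_cont 1"
      using is_pole_zeta_cont by (rule is_pole_imp_not_essential)
  qed
  moreover have "zeta_cont meromorphic_on - {1}"
    using analytic by (rule analytic_on_imp_meromorphic_on)
  ultimately have "zeta_cont meromorphic_on {1} \<union> - {1}"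
    by (rule meromorphic_on_Un)
  hence "zeta_cont meromorphic_on UNIV" by simp
  moreover have "is_pole zeta_cont z \<and> zeta_cont z = 0 \<or> zeta_cont \<midarrow>z\<rightarrow> zeta_cont z" for z
  proof (cases "z = 1")
    case True
    thus ?thesis using is_pole_zeta_cont by (simp add: zeta_cont_def)
  next
    case False
    hence "isCont zeta_cont z"
      using analytic by (intro analytic_at_imp_isCont) (auto elim: analytic_on_subset)
    thus ?thesis by (simp add: isCont_def)
  qed
  moreover have "(\<lambda>n. of_nat (Suc n) powr - s) sums zeta_cont s" if "Re s > 1" for s
  proof -
    have "s \<noteq> 1" using that by auto
    hence "zeta_cont s = dirichlet_zeta s"
      using that by (simp add: zeta_cont_right zeta_right_eq_dirichlet)
    thus ?thesis using dirichlet_zeta_sums[OF that] by simp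
  qed
  ultimately show ?thesis
    by (simp add: is_zeta_def nicely_meromorphic_on_def)
qed

lemma zeta_eq_zeta_cont: "zeta = zeta_cont"
  unfolding zeta_def using is_zeta_zeta_cont by (intro the_equality is_zeta_unique)

lemma zeta_holomorphic: "zeta holomorphic_on - {1}"
  unfolding zeta_eq_zeta_cont by (rule zeta_cont_holomorphic)

lemma is_pole_zeta: "is_pole zeta 1"
  unfolding zeta_eq_zeta_cont by (rule is_pole_zeta_cont)

lemma zeta_residue: "(\<lambda>s. (s - 1) * zeta s) \<midarrow>1\<rightarrow> 1"
proof -
  obtain h where h: "isCont h 1" and eq: "\<forall>\<^sub>F s in at 1. zeta_cont s = rGamma s / (s - 1) + h s"
    by (rule zeta_cont_near_1)
  have "\<forall>\<^sub>F s in at 1. rGamma s + (s - 1) * h s = (s - 1) * zeta s"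
    using eq eventually_neq_at_within[of 1 1 UNIV]
    by eventually_elim (simp add: zeta_eq_zeta_cont distrib_left)
  moreover have "isCont rGamma (1::complex)" by (intro isCont_rGamma) simp
  hence "(\<lambda>s. rGamma s + (s - 1) * h s) \<midarrow>1\<rightarrow> rGamma 1 + (1 - 1) * h 1"
    using h unfolding isCont_def by (intro tendsto_intros)
  ultimately show ?thesis
    by (simp add: Lim_transform_eventually)
qed

lemma zeta_sums: "Re s > 1 \<Longrightarrow> (\<lambda>n. of_nat (Suc n) powr - s) sums zeta s"
  using is_zeta_zeta_cont by (simp add: is_zeta_def zeta_eq_zeta_cont)

text \<open>At 0 the functional equation meets the pole of \<open>zeta (1 - s)\<close>, so this
  value excludes 0 from the zeros separately. The factor \<open>rGamma 0 = 0\<close> leaves only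
  \<open>- rGamma 1 / 2\<close>.\<close>

lemma zeta_0: "zeta 0 = - 1 / 2"
proof -
  have "rGamma (0::complex) = 0" using rGamma_plus1[of "0::complex"] by simp
  thus ?thesis by (simp add: zeta_eq_zeta_cont zeta_cont_right zeta_right_def)
qed

text \<open>Holds by construction for \<open>Re s < 0\<close> and extends by continuation. The point
  0, whose reflection is the pole, is removed; the punctured half-plane is still connected.\<close>

theorem zeta_functional_equation:
  assumes "Re s < 1" "s \<noteq> 0"
  shows "zeta s = 2 * of_real (2 * pi) powr (s - 1) * Gamma (1 - s) * sin (of_real pi * s / 2) * zeta (1 - s)"
proof (rule analytic_continuation_open[where f = zeta and s = "{s. Re s < 0}" and s' = "{s. Re s < 1} - {0}"])
  show "connected ({s. Re s < 1} - {0::complex})"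
    by (intro connected_open_delete open_halfspace_Re_lt convex_connected convex_halfspace_Re_lt) simp
  show "zeta holomorphic_on {s. Re s < 1} - {0}"
    by (rule holomorphic_on_subset[OF zeta_holomorphic]) auto
  have "(zeta \<circ> (\<lambda>s. 1 - s)) holomorphic_on {s. Re s < 1} - {0}"
    by (intro holomorphic_on_compose_gen[OF _ zeta_holomorphic] holomorphic_intros) auto
  moreover have "1 - s \<notin> \<int>\<^sub>\<le>\<^sub>0" if "Re s < 1" for s
    using that by (auto elim!: nonpos_Ints_cases simp: complex_eq_iff)
  ultimately show "(\<lambda>s. 2 * of_real (2 * pi) powr (s - 1) * Gamma (1 - s) * sin (of_real pi * s / 2) *
      zeta (1 - s)) holomorphic_on {s. Re s < 1} - {0}"
    unfolding o_def by (intro holomorphic_intros) auto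
  show "zeta z = 2 * of_real (2 * pi) powr (z - 1) * Gamma (1 - z) * sin (of_real pi * z / 2) * zeta (1 - z)"
    if "z \<in> {s. Re s < 0}" for z
  proof -
    have "Re (1 - z) > 1" "1 - z \<noteq> 1" using that by auto
    hence "zeta (1 - z) = dirichlet_zeta (1 - z)"
      by (simp add: zeta_eq_zeta_cont zeta_cont_right zeta_right_eq_dirichlet)
    thus ?thesis
      using that by (simp add: zeta_eq_zeta_cont zeta_cont_left zeta_left_def)
  qed
  show "{s. Re s < 0} \<noteq> ({} :: complex set)"
    by (auto intro!: exI[of _ "-1"])
qed (use assms in \<open>auto simp: open_halfspace_Re_lt open_delete\<close>)

text \<open>In the open strip the power, Gamma and sine factors do not vanish: the zeros of the sine
  are the even integers.\<close>

lemma zeta_zero_reflect: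
  assumes "0 < Re s" "Re s < 1" "zeta s = 0"
  shows "zeta (1 - s) = 0"
proof -
  have "1 - s \<notin> \<int>\<^sub>\<le>\<^sub>0" using assms(2) by (auto elim!: nonpos_Ints_cases simp: complex_eq_iff)
  hence "Gamma (1 - s) \<noteq> 0" by (simp add: Gamma_eq_zero_iff)
  moreover have "sin (of_real pi * s / 2) \<noteq> 0"
  proof
    assume "sin (of_real pi * s / 2) = 0"
    then obtain n :: int where "of_real pi * s / 2 = of_real (n * pi)" unfolding sin_eq_0 by blast
    hence "s = of_int (2 * n)" by (simp add: field_simps)
    hence "0 < 2 * n" "2 * n < 1" using assms(1,2) by simp_all
    thus False by presburger
  qed
  moreover have "s \<noteq> 0" using assms by auto
  ultimately show ?thesis
    using zeta_functional_equation[of s] assms by simp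
qed

text \<open>As \<open>Re (1 - s) >= 1\<close>, the only factor of the functional equation that can
  vanish is the sine, so s is an even integer. The hypothesis \<open>nonzero\<close> is later
  discharged by \<open>zeta_nonzero_Re_ge_1\<close>.\<close>

lemma zeta_zero_imp_trivial:
  assumes "Re s \<le> 0" "zeta s = 0" and nonzero: "\<And>z. Re z \<ge> 1 \<Longrightarrow> z \<noteq> 1 \<Longrightarrow> zeta z \<noteq> 0"
  shows "s \<in> trivial_zeros"
proof -
  have s: "s \<noteq> 0" using zeta_0 assms by auto
  have "1 - s \<notin> \<int>\<^sub>\<le>\<^sub>0" using assms(1) by (auto elim!: nonpos_Ints_cases simp: complex_eq_iff)
  hence "Gamma (1 - s) \<noteq> 0" by (simp add: Gamma_eq_zero_iff)
  moreover have "zeta (1 - s) \<noteq> 0" using assms s by (intro nonzero) auto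
  ultimately have "sin (of_real pi * s / 2) = 0"
    using zeta_functional_equation[of s] assms s by simp
  then obtain n :: int where "of_real pi * s / 2 = of_real (n * pi)" unfolding sin_eq_0 by blast
  hence n: "s = of_int (2 * n)" by (simp add: field_simps)
  have "n < 0"
    using assms(1) s unfolding n by (cases "n = 0") auto
  hence "s = - 2 * of_nat (nat (- n))" "nat (- n) \<ge> 1"
    by (simp_all add: n)
  thus ?thesis unfolding trivial_zeros_def by blast
qed

section \<open>Non-vanishing on the closed half-plane\<close>

lemma of_nat_mult_powr:
  "complex_of_nat (m * n) powr s = of_nat m powr s * of_nat n powr s"
  using powr_times_real[of "of_nat m" "of_nat n" s] by simp

text \<open>An unordered sum, because the sieve below removes infinite subsets of indices.\<close>

lemma zeta_has_sum:
  assumes "Re s > 1"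
  shows "((\<lambda>n. of_nat n powr -s) has_sum zeta s) {0<..}"
proof -
  have "summable (\<lambda>n. norm (of_nat (Suc n) powr -s))"
    using summable_nat_powr[OF assms] by (simp add: norm_of_nat_powr del: of_nat_Suc)
  hence "((\<lambda>n. of_nat (Suc n) powr -s) has_sum zeta s) UNIV"
    using zeta_sums[OF assms] by (rule norm_summable_imp_has_sum)
  hence "((\<lambda>n. of_nat n powr -s) has_sum zeta s) (range Suc)"
    by (subst has_sum_reindex) (simp_all add: o_def)
  also have "range Suc = {0<..}" using greaterThan_0 by simp
  finally show ?thesis .
qed

text \<open>Sieve of Eratosthenes: multiplying by \<open>1 - q powr -s\<close> subtracts the terms
  with index \<open>q * m\<close>, where m runs through the surviving indices, and these are exactly
  the survivors divisible by q.\<close>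

lemma zeta_sieve:
  assumes s: "Re s > 1" and "finite P" "\<And>p. p \<in> P \<Longrightarrow> prime (p::nat)"
  shows "((\<lambda>n. of_nat n powr -s) has_sum (zeta s * (\<Prod>p\<in>P. 1 - of_nat p powr -s)))
           {n. n > 0 \<and> (\<forall>p\<in>P. \<not> p dvd n)}"
  using assms(2,3)
proof (induction P rule: finite_induct)
  case empty
  thus ?case using zeta_has_sum[OF s] by (simp add: greaterThan_def)
next
  case (insert q P)
  let ?f = "\<lambda>n. complex_of_nat n powr -s"
  let ?Z = "zeta s * (\<Prod>p\<in>P. 1 - of_nat p powr -s)"
  let ?A = "{n. n > 0 \<and> (\<forall>p\<in>P. \<not> p dvd n)}"
  have A: "(?f has_sum ?Z) ?A" using insert by simp
  have q: "prime q" "q > 0" using insert.prems by (auto simp: prime_gt_0_nat)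
  \<comment> \<open>Multiplication by the new prime q does not affect divisibility by the earlier
    primes.\<close>
  have dvd: "p dvd q * m \<longleftrightarrow> p dvd m" if "p \<in> P" for p m
  proof -
    have "p \<noteq> q" using that insert.hyps by auto
    hence "\<not> p dvd q" using that insert.prems q by (metis insertI2 primes_dvd_imp_eq)
    thus ?thesis using that insert.prems by (auto simp: prime_dvd_mult_iff)
  qed
  have "((\<lambda>m. ?f q * ?f m) has_sum (?f q * ?Z)) ?A"
    using A by (rule has_sum_cmult_right)
  hence "((?f \<circ> (\<lambda>m. q * m)) has_sum (?f q * ?Z)) ?A"
    by (simp only: o_def of_nat_mult_powr)
  hence "(?f has_sum (?f q * ?Z)) ((\<lambda>m. q * m) ` ?A)"
    using q by (subst has_sum_reindex) (auto intro: inj_onI)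
  moreover have "(\<lambda>m. q * m) ` ?A \<subseteq> ?A" using q dvd by auto
  ultimately have "(?f has_sum (?Z - ?f q * ?Z)) (?A - (\<lambda>m. q * m) ` ?A)"
    using A by (intro has_sum_Diff)
  also have "?A - (\<lambda>m. q * m) ` ?A = {n. n > 0 \<and> (\<forall>p\<in>insert q P. \<not> p dvd n)}"
    using q dvd by (auto elim!: dvdE)
  also have "?Z - ?f q * ?Z = zeta s * (\<Prod>p\<in>insert q P. 1 - of_nat p powr -s)"
    using insert.hyps by (simp add: algebra_simps)
  finally show ?case .
qed

text \<open>After sieving by the primes up to N only the index 1 and indices above N survive, and
  the latter are bounded by a tail of a convergent series. In this form the Euler product shows at
  once that \<open>zeta s\<close> is nonzero.\<close>

lemma zeta_euler_product:
  assumes s: "Re s > 1"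
  shows "(\<lambda>N. zeta s * (\<Prod>p | prime p \<and> p \<le> N. 1 - of_nat p powr -s)) \<longlonglongrightarrow> 1"
proof (rule tendstoI)
  fix e :: real assume e: "e > 0"
  define \<sigma> where "\<sigma> = Re s"
  have \<sigma>: "\<sigma> > 1" using s by (simp add: \<sigma>_def)
  have summ: "summable (\<lambda>n. real n powr -\<sigma>)" using \<sigma> by (simp add: summable_real_powr_iff)
  obtain N0 where N0: "\<And>n. n \<ge> N0 \<Longrightarrow> norm (\<Sum>i. real (i + n) powr -\<sigma>) < e"
    using suminf_exist_split[OF e summ] by auto
  have "dist (zeta s * (\<Prod>p | prime p \<and> p \<le> N. 1 - of_nat p powr -s)) 1 < e" if N: "N \<ge> max N0 1" for N
  proof -
    let ?Z = "zeta s * (\<Prod>p | prime p \<and> p \<le> N. 1 - of_nat p powr -s)"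
    define A where "A = {n. n > 0 \<and> (\<forall>p\<in>{p. prime p \<and> p \<le> N}. \<not> p dvd n)}"
    \<comment> \<open>Extension by zero turns the unordered sum into an ordinary series indexed from
      0, so that its head can be split off.\<close>
    define g where "g n = (if n \<in> A then complex_of_nat n powr -s else 0)" for n
    have "((\<lambda>n. of_nat n powr -s) has_sum ?Z) A"
      unfolding A_def by (rule zeta_sieve[OF s]) auto
    also have "((\<lambda>n. of_nat n powr -s) has_sum ?Z) A \<longleftrightarrow> (g has_sum ?Z) UNIV"
      by (rule has_sum_cong_neutral) (auto simp: g_def)
    finally have sums: "g sums ?Z" by (rule has_sum_imp_sums)
    have g_small: "g n = (if n = 1 then 1 else 0)" if "n \<le> N" for n
    proof (cases "n \<le> 1")
      case True
      thus ?thesis using not_prime_1 by (cases n) (auto simp: g_def A_def)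
    next
      case False
      then obtain p where p: "prime p" "p dvd n" using prime_factor_nat[of n] by auto
      hence "p \<le> N" using that False dvd_imp_le[of p n] by auto
      thus ?thesis using p False by (auto simp: g_def A_def)
    qed
    have "(\<Sum>i<Suc N. g i) = (\<Sum>i<Suc N. if i = 1 then 1 else 0)"
      by (intro sum.cong) (simp_all add: g_small)
    also have "\<dots> = 1" using N by (subst sum.delta) auto
    finally have "(\<lambda>i. g (i + Suc N)) sums (?Z - 1)"
      using sums_split_initial_segment[OF sums, of "Suc N"] by simp
    hence "?Z - 1 = (\<Sum>i. g (i + Suc N))" by (simp add: sums_iff)
    also have "norm \<dots> \<le> (\<Sum>i. real (i + Suc N) powr -\<sigma>)"
    proof (rule norm_suminf_le)
      show "summable (\<lambda>i. real (i + Suc N) powr - \<sigma>)"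
        using summ by (rule summable_ignore_initial_segment)
      show "norm (g (i + Suc N)) \<le> real (i + Suc N) powr - \<sigma>" for i
        unfolding g_def using norm_of_nat_powr[of "i + Suc N" "-s"] by (simp add: \<sigma>_def del: of_nat_add of_nat_Suc)
    qed
    also have "\<dots> < e" using N0[of "Suc N"] N by simp
    finally show ?thesis by (simp add: dist_norm)
  qed
  thus "\<forall>\<^sub>F N in sequentially. dist (zeta s * (\<Prod>p | prime p \<and> p \<le> N. 1 - of_nat p powr -s)) 1 < e"
    by (rule eventually_sequentiallyI)
qed

text \<open>Real part of the logarithmic series; the term for n = 0 vanishes by the convention on
  division by zero.\<close>

lemma ln_norm_one_minus_sums:
  assumes "cmod w < 1"
  shows "(\<lambda>n. - (Re (w ^ n) / real n)) sums ln (cmod (1 - w))"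
proof -
  have "(\<lambda>n. - ((- (- w)) ^ n) / of_nat n) sums ln (1 + - w)"
    using assms by (intro Ln_series') simp
  from sums_Re[OF this] have "(\<lambda>n. - (Re (w ^ n) / real n)) sums Re (ln (1 - w))"
    by simp
  moreover have "1 - w \<noteq> 0" using assms by auto
  ultimately show ?thesis by simp
qed

text \<open>The logarithm of the product is a sum of terms \<open>- 2 * (1 + Re (z ^ n))\<^sup>2 * r ^ n / n\<close>.\<close>

lemma three_four_one:
  assumes r: "0 \<le> r" "r < 1" and z: "cmod z = 1"
  shows "(cmod (1 - of_real r)) ^ 3 * (cmod (1 - of_real r * z)) ^ 4 * cmod (1 - of_real r * z\<^sup>2) \<le> 1"
proof -
  have w: "cmod (of_real r) < 1" "cmod (of_real r * z) < 1" "cmod (of_real r * z\<^sup>2) < 1"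
    using r z by (simp_all add: norm_mult norm_power)
  have pos: "cmod (1 - of_real r) > 0" "cmod (1 - of_real r * z) > 0" "cmod (1 - of_real r * z\<^sup>2) > 0"
    using w by auto
  have "3 * ln (cmod (1 - of_real r)) + 4 * ln (cmod (1 - of_real r * z)) + ln (cmod (1 - of_real r * z\<^sup>2)) \<le> 0"
  proof (rule sums_le[OF _ _ sums_zero])
    show "(\<lambda>n. 3 * - (Re (of_real r ^ n) / real n) + 4 * - (Re ((of_real r * z) ^ n) / real n) +
            - (Re ((of_real r * z\<^sup>2) ^ n) / real n)) sums
          (3 * ln (cmod (1 - of_real r)) + 4 * ln (cmod (1 - of_real r * z)) + ln (cmod (1 - of_real r * z\<^sup>2)))"
      by (intro sums_add sums_mult ln_norm_one_minus_sums w)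
    show "3 * - (Re (of_real r ^ n) / real n) + 4 * - (Re ((of_real r * z) ^ n) / real n) +
            - (Re ((of_real r * z\<^sup>2) ^ n) / real n) \<le> 0" for n
    proof -
      define u where "u = z ^ n"
      have "cmod u = 1" using z by (simp add: u_def norm_power)
      hence u: "(Re u)\<^sup>2 + (Im u)\<^sup>2 = 1" by (metis cmod_power2 one_power2)
      have "Re (of_real r ^ n) = r ^ n" by (simp flip: of_real_power)
      moreover have "Re ((of_real r * z) ^ n) = r ^ n * Re u"
        by (simp add: power_mult_distrib u_def flip: of_real_power)
      moreover have "Re ((of_real r * z\<^sup>2) ^ n) = r ^ n * Re (u\<^sup>2)"
        by (simp add: power_mult_distrib u_def mult.commute flip: of_real_power power_mult)
      \<comment> \<open>Double angle on the unit circle: with \<open>c = Re u\<close>,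
        \<open>3 + 4 * c + (2 * c^2 - 1) = 2 * (1 + c)^2\<close>.\<close>
      moreover have "Re (u\<^sup>2) = 2 * (Re u)\<^sup>2 - 1"
        using u by (simp add: power2_eq_square)
      ultimately have "3 * - (Re (of_real r ^ n) / real n) + 4 * - (Re ((of_real r * z) ^ n) / real n) +
            - (Re ((of_real r * z\<^sup>2) ^ n) / real n) = - (2 * (1 + Re u)\<^sup>2 * r ^ n / real n)"
        by (simp only:) (simp add: algebra_simps power2_eq_square add_divide_distrib diff_divide_distrib)
      also have "\<dots> \<le> 0" using r by simp
      finally show ?thesis .
    qed
  qed
  also have "3 * ln (cmod (1 - of_real r)) + 4 * ln (cmod (1 - of_real r * z)) + ln (cmod (1 - of_real r * z\<^sup>2)) =
     ln ((cmod (1 - of_real r)) ^ 3 * (cmod (1 - of_real r * z)) ^ 4 * cmod (1 - of_real r * z\<^sup>2))"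
    using pos by (simp add: ln_mult ln_realpow)
  finally show ?thesis using pos by (subst (asm) ln_le_zero_iff) simp_all
qed

text \<open>By \<open>three_four_one\<close> the corresponding expression in the finite Euler
  products is at most 1, whereas zeta times these products tends to 1.\<close>

lemma zeta_three_four_one:
  assumes "\<sigma> > 1"
  shows "cmod (zeta (of_real \<sigma>)) ^ 3 * cmod (zeta (Complex \<sigma> t)) ^ 4 * cmod (zeta (Complex \<sigma> (2 * t))) \<ge> 1"
proof -
  define E where "E s N = (\<Prod>p | prime p \<and> p \<le> N. 1 - of_nat p powr -s)" for s :: complex and N :: nat
  let ?G = "\<lambda>a b c. cmod a ^ 3 * cmod b ^ 4 * cmod c"
  let ?Z = "?G (zeta (of_real \<sigma>)) (zeta (Complex \<sigma> t)) (zeta (Complex \<sigma> (2 * t)))"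
  have E: "?G (E (of_real \<sigma>) N) (E (Complex \<sigma> t) N) (E (Complex \<sigma> (2 * t)) N) \<le> 1" for N
  proof -
    have "?G (E (of_real \<sigma>) N) (E (Complex \<sigma> t) N) (E (Complex \<sigma> (2 * t)) N) =
      (\<Prod>p | prime p \<and> p \<le> N. ?G (1 - of_nat p powr - of_real \<sigma>) (1 - of_nat p powr - Complex \<sigma> t)
         (1 - of_nat p powr - Complex \<sigma> (2 * t)))"
      by (simp only: E_def prod_norm[symmetric] prod.distrib prod_power_distrib)
    also have "\<dots> \<le> (\<Prod>p | prime p \<and> p \<le> N. 1)"
    proof (intro prod_mono conjI)
      fix p assume "p \<in> {p. prime p \<and> p \<le> N}"
      hence p: "p > 1" using prime_gt_1_nat by simp
      \<comment> \<open>The power of p is split into its modulus \<open>r\<close> and a unimodular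
        \<open>z\<close>; doubling t squares \<open>z\<close>.\<close>
      define z where "z = complex_of_nat p powr - Complex 0 t"
      define r where "r = real p powr - \<sigma>"
      have r: "0 \<le> r" "r < 1" using p assms by (simp_all add: r_def powr_less_one)
      have z: "cmod z = 1" using p by (simp add: z_def norm_of_nat_powr)
      have r': "complex_of_nat p powr - of_real \<sigma> = of_real r"
        using powr_of_real[of "real p" "- \<sigma>"] by (simp add: r_def)
      have "- Complex \<sigma> t = - of_real \<sigma> + - Complex 0 t"
        "- Complex \<sigma> (2 * t) = - of_real \<sigma> + (- Complex 0 t + - Complex 0 t)"
        by (simp_all add: complex_eq_iff)
      hence "complex_of_nat p powr - Complex \<sigma> t = of_real r * z"
        "complex_of_nat p powr - Complex \<sigma> (2 * t) = of_real r * z\<^sup>2"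
        by (simp_all only: powr_add r' z_def power2_eq_square)
      thus "?G (1 - of_nat p powr - of_real \<sigma>) (1 - of_nat p powr - Complex \<sigma> t)
         (1 - of_nat p powr - Complex \<sigma> (2 * t)) \<le> 1"
        using three_four_one[OF r z] r' by simp
    qed simp
    finally show ?thesis by simp
  qed
  have "(\<lambda>N. ?G (zeta (of_real \<sigma>) * E (of_real \<sigma>) N) (zeta (Complex \<sigma> t) * E (Complex \<sigma> t) N)
      (zeta (Complex \<sigma> (2 * t)) * E (Complex \<sigma> (2 * t)) N)) \<longlonglongrightarrow> ?G 1 1 1"
    unfolding E_def using assms by (intro tendsto_intros zeta_euler_product) simp_all
  hence "(\<lambda>N. ?Z * ?G (E (of_real \<sigma>) N) (E (Complex \<sigma> t) N) (E (Complex \<sigma> (2 * t)) N)) \<longlonglongrightarrow> 1"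
    by (simp add: norm_mult power_mult_distrib mult_ac)
  moreover have "?Z * ?G (E (of_real \<sigma>) N) (E (Complex \<sigma> t) N) (E (Complex \<sigma> (2 * t)) N) \<le> ?Z" for N
    using mult_left_mono[OF E[of N], of ?Z] by simp
  ultimately show ?thesis
    by (intro tendsto_upperbound) auto
qed

text \<open>Let the real part \<open>1 + x\<close> tend to 1 from the right: the pole contributes
  \<open>x^-3\<close>, a zero at \<open>1 + i t\<close> at least \<open>x^4\<close>, and the third
  factor stays bounded. The product would tend to 0, contrary to
  \<open>zeta_three_four_one\<close>.\<close>

lemma zeta_nonzero_line_1:
  assumes "t \<noteq> 0"
  shows "zeta (Complex 1 t) \<noteq> 0"
proof
  assume zero: "zeta (Complex 1 t) = 0"
  define d where "d = deriv zeta (Complex 1 t)"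
  define u where "u x = complex_of_real x" for x
  have ne: "Complex 1 t \<noteq> 1" "Complex 1 (2 * t) \<noteq> 1" using assms by (auto simp: complex_eq_iff)
  have u: "filterlim (\<lambda>x. a + u x) (at a) (at_right 0)" for a
  proof (rule filterlim_atI)
    show "((\<lambda>x. a + u x) \<longlongrightarrow> a) (at_right 0)"
      unfolding u_def by (auto intro!: tendsto_eq_intros)
    show "\<forall>\<^sub>F x in at_right 0. a + u x \<noteq> a"
      using eventually_at_right_less[of "0::real"] by eventually_elim (simp add: u_def)
  qed
  have "((\<lambda>x. (1 + u x - 1) * zeta (1 + u x)) \<longlongrightarrow> 1) (at_right 0)"
    using filterlim_compose[OF zeta_residue u] .
  hence 1: "((\<lambda>x. u x * zeta (1 + u x)) \<longlongrightarrow> 1) (at_right 0)" by simp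
  have "zeta field_differentiable at (Complex 1 t)"
    using ne by (intro holomorphic_on_imp_differentiable_at[OF zeta_holomorphic]) auto
  hence "(zeta has_field_derivative d) (at (Complex 1 t))"
    unfolding d_def by (rule field_differentiable_derivI)
  hence "((\<lambda>y. (zeta y - zeta (Complex 1 t)) / (y - Complex 1 t)) \<longlongrightarrow> d) (at (Complex 1 t))"
    by (simp add: has_field_derivative_iff)
  from filterlim_compose[OF this u] have 2: "((\<lambda>x. zeta (Complex 1 t + u x) / u x) \<longlongrightarrow> d) (at_right 0)"
    using zero by simp
  have "isCont zeta (Complex 1 (2 * t))"
    using ne by (intro field_differentiable_imp_continuous_at
        holomorphic_on_imp_differentiable_at[OF zeta_holomorphic]) auto
  hence "zeta \<midarrow>Complex 1 (2 * t)\<rightarrow> zeta (Complex 1 (2 * t))" by (simp add: isCont_def)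
  from filterlim_compose[OF this u]
  have 3: "((\<lambda>x. zeta (Complex 1 (2 * t) + u x)) \<longlongrightarrow> zeta (Complex 1 (2 * t))) (at_right 0)" .
  have 4: "((\<lambda>x. x) \<longlongrightarrow> (0::real)) (at_right 0)" by (rule tendsto_ident_at)
  \<comment> \<open>The inserted powers of x cancel (three, minus four, and one left over); the
    left-over x forces the limit 0.\<close>
  have "((\<lambda>x. cmod (u x * zeta (1 + u x)) ^ 3 * cmod (zeta (Complex 1 t + u x) / u x) ^ 4 *
           cmod (zeta (Complex 1 (2 * t) + u x)) * x) \<longlongrightarrow>
         cmod 1 ^ 3 * cmod d ^ 4 * cmod (zeta (Complex 1 (2 * t))) * 0) (at_right 0)"
    by (intro tendsto_intros 1 2 3 4)
  moreover have "\<forall>\<^sub>F x in at_right 0. 1 \<le> cmod (u x * zeta (1 + u x)) ^ 3 *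
     cmod (zeta (Complex 1 t + u x) / u x) ^ 4 * cmod (zeta (Complex 1 (2 * t) + u x)) * x"
    using eventually_at_right_less[of "0::real"]
  proof eventually_elim
    case (elim x)
    have eqs: "1 + u x = of_real (1 + x)" "Complex 1 t + u x = Complex (1 + x) t"
      "Complex 1 (2 * t) + u x = Complex (1 + x) (2 * t)"
      by (simp_all add: u_def complex_eq_iff)
    let ?a = "cmod (zeta (of_real (1 + x)))" and ?b = "cmod (zeta (Complex (1 + x) t))"
      and ?c = "cmod (zeta (Complex (1 + x) (2 * t)))"
    have "cmod (u x * zeta (1 + u x)) ^ 3 * cmod (zeta (Complex 1 t + u x) / u x) ^ 4 *
       cmod (zeta (Complex 1 (2 * t) + u x)) * x = (x * ?a) ^ 3 * (?b / x) ^ 4 * ?c * x"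
      unfolding eqs using elim by (simp add: u_def norm_mult norm_divide)
    also have "\<dots> = ?a ^ 3 * ?b ^ 4 * ?c"
      using elim by (simp add: power_mult_distrib power_divide eval_nat_numeral)
    also have "\<dots> \<ge> 1" using zeta_three_four_one[of "1 + x" t] elim by simp
    finally show ?case .
  qed
  ultimately have "1 \<le> cmod 1 ^ 3 * cmod d ^ 4 * cmod (zeta (Complex 1 (2 * t))) * 0"
    by (intro tendsto_lowerbound) auto
  thus False by simp
qed

theorem zeta_nonzero_Re_ge_1:
  assumes "Re s \<ge> 1" "s \<noteq> 1"
  shows "zeta s \<noteq> 0"
proof (cases "Re s > 1")
  case True
  show ?thesis
  proof
    assume "zeta s = 0"
    with zeta_euler_product[OF True] have "(\<lambda>_::nat. 0::complex) \<longlonglongrightarrow> 1" by simp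
    thus False using LIMSEQ_unique[OF tendsto_const] by force
  qed
next
  case False
  hence "s = Complex 1 (Im s)" "Im s \<noteq> 0" using assms by (auto simp: complex_eq_iff)
  thus ?thesis using zeta_nonzero_line_1[of "Im s"] by simp
qed

section \<open>Newton maps on the sphere\<close>

lemma topspace_riemann_sphere: "topspace riemann_sphere = UNIV"
  by (auto simp: riemann_sphere_def UNIV_option_conv)

text \<open>Used in both directions: it makes a closure that misses infinity compact, and a closed
  ball closed in the sphere.\<close>

lemma closedin_riemann_sphere_image_Some:
  "closedin riemann_sphere (Some ` K) \<longleftrightarrow> compact K"
  by (auto simp: riemann_sphere_def compact_imp_closed)

lemma sphere_map_cases:
  assumes "F meromorphic_on {z}"
  obtains "sphere_map F z = None"
  | c where "F \<midarrow>z\<rightarrow> c" "sphere_map F z = Some c" "remove_sings F analytic_on {z}"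
proof (cases "is_pole F z")
  case True
  thus ?thesis using that(1) by (simp add: sphere_map_def)
next
  case False
  have F: "isolated_singularity_at F z" "not_essential F z"
    using assms by (simp_all add: meromorphic_at_iff)
  with False obtain c where c: "F \<midarrow>z\<rightarrow> c" by (auto simp: not_essential_def)
  hence "remove_sings F z = c" by (rule remove_sings_eqI)
  thus ?thesis
    using False c remove_sings_analytic_at[OF F(1) c] by (intro that(2)) (simp_all add: sphere_map_def)
qed

lemma sphere_map_eq_SomeI:
  assumes "F \<midarrow>z\<rightarrow> c"
  shows "sphere_map F z = Some c"
proof -
  have "\<not> is_pole F z"
    using not_tendsto_and_filterlim_at_infinity[OF at_neq_bot assms] by (auto simp: is_pole_def)
  moreover have "remove_sings F z = c" using assms by (rule remove_sings_eqI)
  ultimately show ?thesis by (simp add: sphere_map_def)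
qed

lemma compact_subset_ball_imp_subset_cball:
  fixes C :: "'a::real_normed_vector set"
  assumes "compact C" "C \<subseteq> ball 0 1"
  obtains r where "0 < r" "r < 1" "C \<subseteq> cball 0 r"
proof (cases "C = {}")
  case True
  thus ?thesis using that[of "1 / 2"] by simp
next
  case False
  have "continuous_on C norm" by (intro continuous_intros)
  from continuous_attains_sup[OF assms(1) False this]
  obtain x where x: "x \<in> C" "\<And>y. y \<in> C \<Longrightarrow> norm y \<le> norm x" by blast
  have "norm x < 1" using x(1) assms(2) by auto
  thus ?thesis using x(2) by (intro that[of "max (norm x) (1 / 2)"]) force+
qed

lemma sphere_map_fixed_point:
  assumes mero: "F meromorphic_on D" and disk: "topological_disk D"
    and cl: "riemann_sphere closure_of (sphere_map F ` D) \<subseteq> Some ` D"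
  shows "\<exists>z\<in>D. sphere_map F z = Some z"
proof -
  \<comment> \<open>The closure with infinity stripped off. All values of the sphere map on D lie in
    it, so F has no poles in D and \<open>G\<close> below is a continuous self-map of D.\<close>
  define K where "K = {z. Some z \<in> riemann_sphere closure_of (sphere_map F ` D)}"
  have K: "riemann_sphere closure_of (sphere_map F ` D) = Some ` K" "K \<subseteq> D"
    using cl by (auto simp: K_def)
  have "compact K"
    using closedin_closure_of[of riemann_sphere "sphere_map F ` D"]
    unfolding K closedin_riemann_sphere_image_Some .
  have "sphere_map F ` D \<subseteq> Some ` K"
    unfolding K(1)[symmetric] by (rule closure_of_subset) (simp add: topspace_riemann_sphere)
  define G where "G = remove_sings F"
  have G: "sphere_map F z = Some (G z)" "G z \<in> K" "isCont G z" if "z \<in> D" for z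
  proof -
    have "sphere_map F z \<in> Some ` K" using that \<open>sphere_map F ` D \<subseteq> Some ` K\<close> by auto
    moreover have "F meromorphic_on {z}" using mero that by (auto elim: meromorphic_on_subset)
    ultimately obtain c where c: "F \<midarrow>z\<rightarrow> c" "sphere_map F z = Some c" "G analytic_on {z}" "c \<in> K"
      by (auto simp: G_def elim: sphere_map_cases)
    have "G z = c" unfolding G_def using c(1) by (rule remove_sings_eqI)
    thus "sphere_map F z = Some (G z)" "G z \<in> K" "isCont G z"
      using c analytic_at_imp_isCont by auto
  qed
  obtain h h' where hom: "homeomorphism D (ball (0::complex) 1) h h'"
    using disk unfolding topological_disk_def homeomorphic_def by blast
  have "compact (h ` K)"
    using \<open>compact K\<close> K(2) homeomorphism_cont1[OF hom]
    by (intro compact_continuous_image) (auto elim: continuous_on_subset)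
  moreover have "h ` K \<subseteq> ball 0 1" using K(2) homeomorphism_image1[OF hom] by blast
  ultimately obtain r where r: "0 < r" "r < 1" "h ` K \<subseteq> cball 0 r"
    by (rule compact_subset_ball_imp_subset_cball)
  have sub: "cball 0 r \<subseteq> ball (0::complex) 1" using r by auto
  have h': "h' x \<in> D" if "x \<in> cball 0 r" for x
    using that sub homeomorphism_image2[OF hom] by blast
  \<comment> \<open>Conjugation by the homeomorphism gives a self-map of the closed ball of radius
    r, which contains the image of K.\<close>
  have "continuous_on (cball 0 r) (\<lambda>x. h (G (h' x)))"
  proof (intro continuous_on_compose2[OF homeomorphism_cont1[OF hom]])
    show "continuous_on (cball 0 r) (\<lambda>x. G (h' x))"
    proof (rule continuous_on_compose2[of D G])
      show "continuous_on D G" using G(3) by (rule continuous_at_imp_continuous_on[rule_format])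
      show "continuous_on (cball 0 r) h'"
        using homeomorphism_cont2[OF hom] sub by (rule continuous_on_subset)
    qed (use h' in auto)
  qed (use h' G(2) K(2) in auto)
  moreover have "(\<lambda>x. h (G (h' x))) \<in> cball 0 r \<rightarrow> cball 0 r"
    using r(3) h' G(2) by blast
  ultimately obtain x where x: "x \<in> cball 0 r" "h (G (h' x)) = x"
    using brouwer_ball[OF r(1)] by metis
  have "G (h' x) \<in> D" using G(2) h'[OF x(1)] K(2) by blast
  hence "G (h' x) = h' x" using homeomorphism_apply1[OF hom] x(2) by metis
  thus ?thesis using G(1) h'[OF x(1)] by metis
qed

text \<open>At zeros of \<open>deriv f\<close> division by zero gives the value \<open>z\<close>,
  which would turn critical points into fixed points; hence fixed points are taken for
  \<open>sphere_map\<close> of this function, which uses limits.\<close>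

definition newton_map :: "(complex \<Rightarrow> complex) \<Rightarrow> complex \<Rightarrow> complex" where
  "newton_map f z = z - f z / deriv f z"

lemma newton_map_meromorphic:
  assumes "f meromorphic_on A"
  shows "newton_map f meromorphic_on A"
  unfolding newton_map_def using assms by (intro meromorphic_intros)

text \<open>Otherwise zeros of \<open>deriv f\<close> accumulate at z, so the derivative vanishes
  identically and f is constant.\<close>

lemma eventually_deriv_nonzero:
  assumes f: "f holomorphic_on S" "open S" "connected S" "\<not> f constant_on S" and z: "z \<in> S"
  shows "\<forall>\<^sub>F w in at z. deriv f w \<noteq> 0"
proof (rule ccontr)
  assume *: "\<not> (\<forall>\<^sub>F w in at z. deriv f w \<noteq> 0)"
  have f': "deriv f holomorphic_on S" using f(1,2) by (rule holomorphic_deriv)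
  have "\<forall>\<^sub>F w in at z. w \<in> S" using f(2) z by (rule eventually_at_in_open')
  hence "\<exists>\<^sub>F w in at z. w \<in> S \<and> deriv f w = 0"
    using * unfolding not_eventually by (auto elim: frequently_rev_mp eventually_mono)
  hence lim: "z islimpt {w\<in>S. deriv f w = 0}"
    by (simp add: islimpt_conv_frequently_at)
  have "deriv f w = 0" if "w \<in> S" for w
    by (rule analytic_continuation[OF f' f(2,3) _ z lim]) (use that in simp_all)
  hence "(f has_field_derivative 0) (at w)" if "w \<in> S" for w
    using holomorphic_derivI[OF f(1,2) that] that by simp
  hence "f constant_on S" using f(2,3) by (intro has_field_derivative_0_imp_constant_on)
  with f(4) show False by contradiction
qed

text \<open>Near z, \<open>f w = (w - newton_map f w) * deriv f w\<close>, and both factors have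
  limits at z; this covers points with \<open>deriv f z = 0\<close>.\<close>

lemma newton_map_fixed_point:
  assumes f: "f holomorphic_on S" "open S" "connected S" "\<not> f constant_on S" and z: "z \<in> S"
    and fp: "sphere_map (newton_map f) z = Some z"
  shows "f z = 0"
proof -
  have "f analytic_on {z}" using f z by (metis analytic_at)
  hence "newton_map f meromorphic_on {z}"
    by (intro newton_map_meromorphic analytic_on_imp_meromorphic_on)
  with fp have lim: "newton_map f \<midarrow>z\<rightarrow> z" by (auto elim: sphere_map_cases)
  have f': "deriv f holomorphic_on S" using f(1,2) by (rule holomorphic_deriv)
  have cont: "isCont f z" "isCont (deriv f) z"
    using f(1,2) f' z holomorphic_on_imp_differentiable_at field_differentiable_imp_continuous_at by blast+
  have "((\<lambda>w. (w - newton_map f w) * deriv f w) \<longlongrightarrow> (z - z) * deriv f z) (at z)"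
    using lim cont(2) by (intro tendsto_intros) (simp_all add: isCont_def)
  moreover have "\<forall>\<^sub>F w in at z. (w - newton_map f w) * deriv f w = f w"
    using eventually_deriv_nonzero[OF f z] by eventually_elim (simp add: newton_map_def)
  ultimately have "(f \<longlongrightarrow> (z - z) * deriv f z) (at z)"
    by (rule Lim_transform_eventually)
  with cont(1) show ?thesis
    using tendsto_unique[OF at_neq_bot] unfolding isCont_def by fastforce
qed

text \<open>With \<open>f w = (w - rho)^n * g w\<close>, \<open>g\<close> nonzero, the Newton map is
  \<open>rho + (w - rho) * k w\<close> near rho, where \<open>k\<close> is continuous at rho with
  value \<open>1 - 1 / n\<close>. Simple and multiple zeros are treated alike.\<close>

lemma newton_map_attracting:
  assumes f: "f holomorphic_on S" "open S" "connected S" "\<not> f constant_on S"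
    and \<rho>: "\<rho> \<in> S" "f \<rho> = 0"
  obtains \<delta> \<mu> where "\<delta> > 0" "0 \<le> \<mu>" "\<mu> < 1"
    "\<And>z. z \<in> ball \<rho> \<delta> \<Longrightarrow> \<exists>w. sphere_map (newton_map f) z = Some w \<and> dist \<rho> w \<le> \<mu> * dist \<rho> z"
proof -
  obtain g r n where n: "0 < n" and r: "0 < r" "ball \<rho> r \<subseteq> S" and g: "g holomorphic_on ball \<rho> r"
    and fg: "\<And>w. w \<in> ball \<rho> r \<Longrightarrow> f w = (w - \<rho>) ^ n * g w"
    and g0: "\<And>w. w \<in> ball \<rho> r \<Longrightarrow> g w \<noteq> 0"
    using holomorphic_factor_zero_nonconstant[OF f(1-3) \<rho> f(4)] by metis
  \<comment> \<open>The derivative of f with the factor \<open>(w - rho)^(n - 1)\<close> taken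
    out.\<close>
  define d where "d w = of_nat n * g w + (w - \<rho>) * deriv g w" for w
  define k where "k w = 1 - g w / d w" for w
  \<comment> \<open>Halfway between \<open>k rho = 1 - 1 / n\<close> and 1, so
    \<open>cmod (k w)\<close> stays below it near rho.\<close>
  define \<mu> where "\<mu> = 1 - 1 / (2 * real n)"
  have \<mu>: "0 \<le> \<mu>" "\<mu> < 1" using n by (simp_all add: \<mu>_def)
  have \<rho>r: "\<rho> \<in> ball \<rho> r" using r by simp
  have d_holo: "d holomorphic_on ball \<rho> r"
    unfolding d_def using g by (intro holomorphic_intros) auto
  have contd: "isCont d \<rho>" and contg: "isCont g \<rho>"
    using d_holo g \<rho>r holomorphic_on_imp_differentiable_at field_differentiable_imp_continuous_at open_ball
    by blast+
  have d\<rho>: "d \<rho> = of_nat n * g \<rho>" by (simp add: d_def)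
  hence "d \<rho> \<noteq> 0" using n g0[OF \<rho>r] by simp
  hence "isCont k \<rho>" unfolding k_def using contd contg by (intro continuous_intros)
  moreover have "k \<rho> = of_real (1 - 1 / real n)"
    using n g0[OF \<rho>r] by (simp add: k_def d\<rho>)
  hence "cmod (k \<rho>) = \<bar>1 - 1 / real n\<bar>" by (simp only: norm_of_real)
  hence "cmod (k \<rho>) < \<mu>" using n by (simp add: \<mu>_def field_simps)
  ultimately have "\<forall>\<^sub>F w in at \<rho>. cmod (k w) < \<mu>"
    unfolding isCont_def by (intro order_tendstoD(2)[of _ "cmod (k \<rho>)"] tendsto_norm)
  hence "\<forall>\<^sub>F w in nhds \<rho>. cmod (k w) < \<mu>"
    using \<open>cmod (k \<rho>) < \<mu>\<close> by (simp add: eventually_nhds_conv_at)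
  moreover have "\<forall>\<^sub>F w in at \<rho>. d w \<noteq> 0"
    using contd \<open>d \<rho> \<noteq> 0\<close> unfolding isCont_def by (intro tendsto_imp_eventually_ne)
  hence "\<forall>\<^sub>F w in nhds \<rho>. d w \<noteq> 0"
    using \<open>d \<rho> \<noteq> 0\<close> by (simp add: eventually_nhds_conv_at)
  moreover have "\<forall>\<^sub>F w in nhds \<rho>. w \<in> ball \<rho> r"
    using \<rho>r by (intro eventually_nhds_in_open) auto
  ultimately have "\<forall>\<^sub>F w in nhds \<rho>. cmod (k w) < \<mu> \<and> d w \<noteq> 0 \<and> w \<in> ball \<rho> r"
    by eventually_elim blast
  then obtain \<delta> where \<delta>: "\<delta> > 0"
    "\<And>w. dist w \<rho> < \<delta> \<Longrightarrow> cmod (k w) < \<mu> \<and> d w \<noteq> 0 \<and> w \<in> ball \<rho> r"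
    unfolding eventually_nhds_metric by blast
  have newton: "newton_map f w = \<rho> + (w - \<rho>) * k w" "deriv f w \<noteq> 0" if w: "dist w \<rho> < \<delta>" "w \<noteq> \<rho>" for w
  proof -
    have wr: "w \<in> ball \<rho> r" "d w \<noteq> 0" using \<delta>(2)[OF w(1)] by auto
    have "(g has_field_derivative deriv g w) (at w)"
      using g wr(1) by (intro holomorphic_derivI) auto
    hence "((\<lambda>w. (w - \<rho>) ^ n * g w) has_field_derivative
             of_nat n * (w - \<rho>) ^ (n - 1) * g w + (w - \<rho>) ^ n * deriv g w) (at w)"
      by (auto intro!: derivative_eq_intros)
    also have "of_nat n * (w - \<rho>) ^ (n - 1) * g w + (w - \<rho>) ^ n * deriv g w = (w - \<rho>) ^ (n - 1) * d w"
      using n by (cases n) (simp_all add: d_def algebra_simps)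
    finally have "(f has_field_derivative (w - \<rho>) ^ (n - 1) * d w) (at w)"
      by (rule has_field_derivative_transform_within_open[OF _ open_ball wr(1)]) (simp add: fg)
    hence f': "deriv f w = (w - \<rho>) ^ (n - 1) * d w" by (rule DERIV_imp_deriv)
    thus "deriv f w \<noteq> 0" using w wr by simp
    have "f w = (w - \<rho>) ^ (n - 1) * ((w - \<rho>) * g w)"
      using fg[OF wr(1)] n by (cases n) simp_all
    moreover have "(w - \<rho>) ^ (n - 1) \<noteq> 0" using w by simp
    ultimately have "f w / deriv f w = (w - \<rho>) * (g w / d w)"
      unfolding f' by simp
    thus "newton_map f w = \<rho> + (w - \<rho>) * k w"
      by (simp only: newton_map_def k_def right_diff_distrib) simp
  qed
  show ?thesis
  proof (rule that[OF \<delta>(1) \<mu>])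
    fix z assume "z \<in> ball \<rho> \<delta>"
    hence z: "dist z \<rho> < \<delta>" by (simp add: dist_commute)
    show "\<exists>w. sphere_map (newton_map f) z = Some w \<and> dist \<rho> w \<le> \<mu> * dist \<rho> z"
    proof (cases "z = \<rho>")
      \<comment> \<open>At a multiple zero the Newton quotient is 0/0, so the value at rho is found
        as a limit.\<close>
      case True
      have "((\<lambda>w. \<rho> + (w - \<rho>) * k w) \<longlongrightarrow> \<rho> + (\<rho> - \<rho>) * k \<rho>) (at \<rho>)"
        using \<open>isCont k \<rho>\<close> unfolding isCont_def by (intro tendsto_intros)
      moreover have "\<forall>\<^sub>F w in at \<rho>. \<rho> + (w - \<rho>) * k w = newton_map f w"
        unfolding eventually_at using \<delta>(1) newton(1) by auto
      ultimately have "newton_map f \<midarrow>\<rho>\<rightarrow> \<rho>"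
        using Lim_transform_eventually by fastforce
      from sphere_map_eq_SomeI[OF this] show ?thesis using True by auto
    next
      case False
      have "z \<in> S" using \<delta>(2)[OF z] r(2) by auto
      have "isCont f z" "isCont (deriv f) z"
        using f(1,2) holomorphic_deriv[OF f(1,2)] \<open>z \<in> S\<close>
          holomorphic_on_imp_differentiable_at field_differentiable_imp_continuous_at by blast+
      hence "isCont (newton_map f) z"
        unfolding newton_map_def using newton(2)[OF z False] by (intro continuous_intros)
      hence "sphere_map (newton_map f) z = Some (newton_map f z)"
        by (intro sphere_map_eq_SomeI) (simp add: isCont_def)
      moreover have "dist \<rho> (newton_map f z) = cmod (k z) * dist \<rho> z"
        unfolding newton(1)[OF z False] by (simp add: dist_norm norm_mult norm_minus_commute mult.commute)
      moreover have "cmod (k z) * dist \<rho> z \<le> \<mu> * dist \<rho> z"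
        using \<delta>(2)[OF z] by (intro mult_right_mono) auto
      ultimately show ?thesis by auto
    qed
  qed
qed

section \<open>The Newton map of zeta and the equivalence\<close>

lemma connected_minus_1: "connected (- {1::complex})"
  by (rule connected_punctured_universe) simp

text \<open>A constant function has no pole, and zeta has one at 1.\<close>

lemma zeta_not_constant: "\<not> zeta constant_on - {1}"
proof
  assume "zeta constant_on - {1}"
  then obtain c where c: "\<And>z. z \<noteq> 1 \<Longrightarrow> zeta z = c" by (auto simp: constant_on_def)
  have "\<forall>\<^sub>F z in at 1. c = zeta z"
    using eventually_neq_at_within[of 1 1 UNIV] by eventually_elim (simp add: c)
  hence "zeta \<midarrow>1\<rightarrow> c" using Lim_transform_eventually[OF tendsto_const] by blast
  thus False
    using is_pole_zeta not_tendsto_and_filterlim_at_infinity[OF at_neq_bot] unfolding is_pole_def by blast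
qed

lemma newton_zeta_altdef: "newton_zeta = sphere_map (newton_map zeta)"
  by (simp add: newton_zeta_def newton_map_def[abs_def])

text \<open>The default value \<open>zeta 1 = 0\<close> must not count as a zero; on the sphere the
  value there is infinity.\<close>

lemma zeta_sphere_eq_0_iff: "zeta_sphere s = Some 0 \<longleftrightarrow> s \<noteq> 1 \<and> zeta s = 0"
proof (cases "s = 1")
  case True
  thus ?thesis using is_pole_zeta by (simp add: zeta_sphere_def sphere_map_def)
next
  case False
  hence "isCont zeta s"
    by (intro field_differentiable_imp_continuous_at
        holomorphic_on_imp_differentiable_at[OF zeta_holomorphic]) auto
  hence "zeta_sphere s = Some (zeta s)"
    unfolding zeta_sphere_def by (intro sphere_map_eq_SomeI) (simp add: isCont_def)
  thus ?thesis using False by simp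
qed

text \<open>The uniform factor \<open>mu < 1\<close> sends the disk into a strictly smaller closed
  ball, which is closed in the sphere and so contains the closure of the image.\<close>

lemma invariant_disk_around_zero:
  assumes "1 / 2 < Re \<rho>" "Re \<rho> < 1" "zeta \<rho> = 0"
  shows "\<exists>D. topological_disk D \<and> D \<subseteq> {z. 1 / 2 < Re z \<and> Re z < 1} \<and>
           riemann_sphere closure_of (newton_zeta ` D) \<subseteq> Some ` D"
proof -
  have \<rho>: "\<rho> \<in> - {1}" and "open (- {1::complex})" using assms(2) by auto
  obtain \<delta> \<mu> where \<delta>: "\<delta> > 0" and \<mu>: "0 \<le> \<mu>" "\<mu> < 1" and newton:
    "\<And>z. z \<in> ball \<rho> \<delta> \<Longrightarrow> \<exists>w. newton_zeta z = Some w \<and> dist \<rho> w \<le> \<mu> * dist \<rho> z"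
    unfolding newton_zeta_altdef
    by (rule newton_map_attracting[OF zeta_holomorphic \<open>open (- {1})\<close> connected_minus_1
          zeta_not_constant \<rho> assms(3)]) blast
  have "open ({z. 1 / 2 < Re z} \<inter> {z. Re z < 1})"
    by (intro open_Int open_halfspace_Re_gt open_halfspace_Re_lt)
  moreover have "\<rho> \<in> {z. 1 / 2 < Re z} \<inter> {z. Re z < 1}" using assms by simp
  ultimately obtain e where e: "e > 0" "ball \<rho> e \<subseteq> {z. 1 / 2 < Re z} \<inter> {z. Re z < 1}"
    by (rule openE)
  define r where "r = min \<delta> e"
  have r: "r > 0" "r \<le> \<delta>" "r \<le> e" using \<delta> e by (simp_all add: r_def)
  have "newton_zeta ` ball \<rho> r \<subseteq> Some ` cball \<rho> (\<mu> * r)"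
  proof
    fix y assume "y \<in> newton_zeta ` ball \<rho> r"
    then obtain z where z: "z \<in> ball \<rho> r" "y = newton_zeta z" by blast
    then obtain w where w: "newton_zeta z = Some w" "dist \<rho> w \<le> \<mu> * dist \<rho> z"
      using newton[of z] r by auto
    have "\<mu> * dist \<rho> z \<le> \<mu> * r" using z \<mu> by (intro mult_left_mono) auto
    thus "y \<in> Some ` cball \<rho> (\<mu> * r)" using z w by auto
  qed
  hence "riemann_sphere closure_of (newton_zeta ` ball \<rho> r) \<subseteq> Some ` cball \<rho> (\<mu> * r)"
    by (rule closure_of_minimal) (simp add: closedin_riemann_sphere_image_Some)
  also have "\<mu> * r < r" using \<mu> r by simp
  hence "Some ` cball \<rho> (\<mu> * r) \<subseteq> Some ` ball \<rho> r" by (intro image_mono) auto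
  finally have "riemann_sphere closure_of (newton_zeta ` ball \<rho> r) \<subseteq> Some ` ball \<rho> r" .
  moreover have "topological_disk (ball \<rho> r)"
    using r by (simp add: topological_disk_def homeomorphic_balls)
  moreover have "ball \<rho> r \<subseteq> {z. 1 / 2 < Re z \<and> Re z < 1}"
    using e r subset_ball[of r e \<rho>] by blast
  ultimately show ?thesis by blast
qed

lemma zero_in_invariant_disk:
  assumes "topological_disk D" "1 \<notin> D" "riemann_sphere closure_of (newton_zeta ` D) \<subseteq> Some ` D"
  shows "\<exists>z\<in>D. zeta z = 0"
proof -
  have "zeta meromorphic_on UNIV"
    using is_zeta_zeta_cont by (simp add: is_zeta_def nicely_meromorphic_on_def zeta_eq_zeta_cont)
  hence "newton_map zeta meromorphic_on D"
    by (intro newton_map_meromorphic) (auto elim: meromorphic_on_subset)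
  then obtain z where z: "z \<in> D" "sphere_map (newton_map zeta) z = Some z"
    using sphere_map_fixed_point[of "newton_map zeta" D] assms by (auto simp: newton_zeta_altdef)
  have "zeta z = 0"
    using z assms(2)
    by (intro newton_map_fixed_point[OF zeta_holomorphic _ connected_minus_1 zeta_not_constant]) auto
  with z show ?thesis by blast
qed

theorem theorem14:
  shows "riemann_hypothesis \<longleftrightarrow>
    \<not> (\<exists>D. topological_disk D \<and> D \<subseteq> {z. 1 / 2 < Re z \<and> Re z < 1} \<and>
          riemann_sphere closure_of (newton_zeta ` D) \<subseteq> Some ` D)"
proof
  assume RH: riemann_hypothesis
  show "\<not> (\<exists>D. topological_disk D \<and> D \<subseteq> {z. 1 / 2 < Re z \<and> Re z < 1} \<and>
          riemann_sphere closure_of (newton_zeta ` D) \<subseteq> Some ` D)"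
  proof safe
    fix D assume D: "topological_disk D" "D \<subseteq> {z. 1 / 2 < Re z \<and> Re z < 1}"
      "riemann_sphere closure_of (newton_zeta ` D) \<subseteq> Some ` D"
    moreover have "1 \<notin> D" using D(2) by auto
    ultimately obtain z where z: "z \<in> D" "zeta z = 0" using zero_in_invariant_disk by blast
    hence "zeta_sphere z = Some 0" using \<open>1 \<notin> D\<close> by (auto simp: zeta_sphere_eq_0_iff)
    moreover have "z \<notin> trivial_zeros" using z D(2) by (auto simp: trivial_zeros_def)
    ultimately have "Re z = 1 / 2" using RH by (simp add: riemann_hypothesis_def)
    thus False using z D(2) by auto
  qed
next
  assume no_disk: "\<not> (\<exists>D. topological_disk D \<and> D \<subseteq> {z. 1 / 2 < Re z \<and> Re z < 1} \<and>
          riemann_sphere closure_of (newton_zeta ` D) \<subseteq> Some ` D)"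
  show riemann_hypothesis
    unfolding riemann_hypothesis_def
  proof (intro allI impI; elim conjE)
    fix s assume "zeta_sphere s = Some 0" and nontrivial: "s \<notin> trivial_zeros"
    hence s: "s \<noteq> 1" "zeta s = 0" by (simp_all add: zeta_sphere_eq_0_iff)
    have "Re s > 0"
      using zeta_zero_imp_trivial[of s] zeta_nonzero_Re_ge_1 s nontrivial by (meson not_le)
    moreover have "Re s < 1" using zeta_nonzero_Re_ge_1[of s] s by (meson not_le)
    moreover have "\<not> (1 / 2 < Re z \<and> Re z < 1 \<and> zeta z = 0)" for z
      using invariant_disk_around_zero[of z] no_disk by blast
    \<comment> \<open>A zero to the left of the line is excluded through its reflection
      \<open>1 - s\<close>, which lies to the right.\<close>
    from this[of s] this[of "1 - s"] have "\<not> (1 / 2 < Re s \<and> Re s < 1)" "\<not> (0 < Re s \<and> Re s < 1 / 2)"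
      using s zeta_zero_reflect[of s] by auto
    ultimately show "Re s = 1 / 2" by linarith
  qed
qed

end
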